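(* Assume $d_I<d_H$. SLINK-SEQ is exponentially consistent: there exists $\alpha>0$ (independent of $C$) such that, as $C\to\infty$, $$\mathbb{E}[N]\le\frac{-\log P_e(C)}{\alpha}\,(1+o(1)),$$ where $N=N(C)$ is the stopping time and $P_e(C)=\mathbb{P}\big[\{C_1(N),\dots,C_K(N)\}\neq\{P_1,\dots,P_K\}\big]$ is the error probability of SLINK-SEQ with parameter $C$.
   Context: Setting: $M\ge2$ mutually independent data sequences; sequence $i$ consists of i.i.d. samples $X^{(i)}_1,X^{(i)}_2,\dots$ from an unknown distribution $p_i$ on $\mathcal X$; $\{1,\dots,M\}$ is partitioned into $K\ge2$ nonempty true clusters $P_1,\dots,P_K$ ($K$ known). $k$ is a measurable positive-definite kernel with $0\le k\le\mathbb{G}$, $\mathcal F$ the unit ball of its RKHS, $d(p,q)=\sup_{f\in\mathcal F}(\mathbb{E}_pf-\mathbb{E}_qf)$ (MMD), $d(i,j)=d(p_i,p_j)$. Estimate: $\hat d(i,j,n)=\Big[\frac1{n^2}\sum_{l,m=1}^n\big(k(X^{(i)}_l,X^{(i)}_m)+k(X^{(j)}_l,X^{(j)}_m)-2k(X^{(i)}_l,X^{(j)}_m)\big)\Big]^{1/2}$. $d_H=\min_{k\neq l}\min_{i\in P_k,j\in P_l}d(i,j)$; $d_I(P_k)=\max\min_{i\in P_{1k},j\in P_{2k}}d(i,j)$ over partitions of $P_k$ into two nonempty disjoint sets (taken as $0$ if $|P_k|=1$); $d_I=\max_kd_I(P_k)$. SLINK with target number $K$ on dissimilarities $\delta$: start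 from singletons, repeatedly merge two current clusters $A\ne B$ minimizing $\min_{i\in A,j\in B}\delta(i,j)$ (ties arbitrary) until $K$ clusters remain. SLINK-SEQ with parameter $C>0$: at each time $n\ge2$ (one new sample of every sequence per time step), run SLINK with target $K$ on $\{\hat d(i,j,n)\}$ to get clusters $C_1(n),\dots,C_K(n)$, and compute $\Gamma_n=\min_{k\neq l}\min_{i\in C_k(n),j\in C_l(n)}\hat d(i,j,n)$; the stopping time is $N=\inf\{n\ge2:\Gamma_n\ge C/\sqrt n\}$ and the output is $\{C_1(N),\dots,C_K(N)\}$. *)

theory Defs
  imports "HOL-Probability.Probability"
begin

text \<open>Elements of the pre-Hilbert space spanned by the sections k(x,.) are
  represented as finite lists of coefficient/point pairs.\<close>

definition kfun :: "('x \<Rightarrow> 'x \<Rightarrow> real) \<Rightarrow> (real \<times> 'x) list \<Rightarrow> 'x \<Rightarrow> real" where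
  "kfun k ps y = (\<Sum>(c,x)\<leftarrow>ps. c * k x y)"

definition knorm2 :: "('x \<Rightarrow> 'x \<Rightarrow> real) \<Rightarrow> (real \<times> 'x) list \<Rightarrow> real" where
  "knorm2 k ps = (\<Sum>(c,x)\<leftarrow>ps. \<Sum>(c',x')\<leftarrow>ps. c * c' * k x x')"

definition pd_kernel :: "('x \<Rightarrow> 'x \<Rightarrow> real) \<Rightarrow> bool" where
  "pd_kernel k \<longleftrightarrow> (\<forall>x y. k x y = k y x) \<and> (\<forall>ps. 0 \<le> knorm2 k ps)"

text \<open>Unit ball of the RKHS, via Aronszajn's completion: pointwise limits of
  Cauchy sequences (in RKHS norm) of finite kernel expansions whose norm tends to
  a limit at most 1.\<close>
definition rkhs_unit_ball :: "('x \<Rightarrow> 'x \<Rightarrow> real) \<Rightarrow> ('x \<Rightarrow> real) set" where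
  "rkhs_unit_ball k = {f. \<exists>g :: nat \<Rightarrow> (real \<times> 'x) list.
      (\<forall>e>0. \<exists>N. \<forall>m\<ge>N. \<forall>n\<ge>N. knorm2 k (g m @ map (\<lambda>(c,x). (-c,x)) (g n)) < e)
    \<and> (\<forall>y. (\<lambda>n. kfun k (g n) y) \<longlonglongrightarrow> f y)
    \<and> (\<exists>L\<le>1. (\<lambda>n. sqrt (knorm2 k (g n))) \<longlonglongrightarrow> L)}"

definition mmd :: "('x \<Rightarrow> 'x \<Rightarrow> real) \<Rightarrow> 'x measure \<Rightarrow> 'x measure \<Rightarrow> real" where
  "mmd k p q = (SUP f\<in>rkhs_unit_ball k. (\<integral>x. f x \<partial>p) - (\<integral>x. f x \<partial>q))"

definition linkage :: "(nat \<Rightarrow> nat \<Rightarrow> real) \<Rightarrow> nat set \<Rightarrow> nat set \<Rightarrow> real" where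
  "linkage \<delta> A B = Min {\<delta> i j | i j. i \<in> A \<and> j \<in> B}"

definition gamma :: "(nat \<Rightarrow> nat \<Rightarrow> real) \<Rightarrow> nat set set \<Rightarrow> real" where
  "gamma \<delta> R = Min {linkage \<delta> A B | A B. A \<in> R \<and> B \<in> R \<and> A \<noteq> B}"

definition is_partition :: "nat \<Rightarrow> nat \<Rightarrow> nat set set \<Rightarrow> bool" where
  "is_partition M K P \<longleftrightarrow> \<Union>P = {..<M} \<and> (\<forall>A\<in>P. A \<noteq> {}) \<and>
     (\<forall>A\<in>P. \<forall>B\<in>P. A \<noteq> B \<longrightarrow> A \<inter> B = {}) \<and> card P = K"

definition d_H :: "(nat \<Rightarrow> nat \<Rightarrow> real) \<Rightarrow> nat set set \<Rightarrow> real" where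
  "d_H d P = gamma d P"

definition d_I_cluster :: "(nat \<Rightarrow> nat \<Rightarrow> real) \<Rightarrow> nat set \<Rightarrow> real" where
  "d_I_cluster d A = (if card A \<le> 1 then 0
     else Max {linkage d B (A - B) | B. B \<subseteq> A \<and> B \<noteq> {} \<and> B \<noteq> A})"

definition d_I :: "(nat \<Rightarrow> nat \<Rightarrow> real) \<Rightarrow> nat set set \<Rightarrow> real" where
  "d_I d P = Max (d_I_cluster d ` P)"

section \<open>SLINK (ties arbitrary: a relation between inputs and admissible outputs)\<close>

inductive slink_run :: "(nat \<Rightarrow> nat \<Rightarrow> real) \<Rightarrow> nat \<Rightarrow> nat set set \<Rightarrow> nat set set \<Rightarrow> bool"
  for \<delta> :: "nat \<Rightarrow> nat \<Rightarrow> real" and K :: nat where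
  finished: "card Cs \<le> K \<Longrightarrow> slink_run \<delta> K Cs Cs"
| merge_step: "K < card Cs \<Longrightarrow> A \<in> Cs \<Longrightarrow> B \<in> Cs \<Longrightarrow> A \<noteq> B \<Longrightarrow>
     (\<forall>A'\<in>Cs. \<forall>B'\<in>Cs. A' \<noteq> B' \<longrightarrow> linkage \<delta> A B \<le> linkage \<delta> A' B') \<Longrightarrow>
     slink_run \<delta> K (insert (A \<union> B) (Cs - {A, B})) R \<Longrightarrow> slink_run \<delta> K Cs R"

definition slink_out :: "(nat \<Rightarrow> nat \<Rightarrow> real) \<Rightarrow> nat \<Rightarrow> nat \<Rightarrow> nat set set \<Rightarrow> bool" where
  "slink_out \<delta> M K R \<longleftrightarrow> slink_run \<delta> K ((\<lambda>i. {i}) ` {..<M}) R"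

definition dhat :: "('x \<Rightarrow> 'x \<Rightarrow> real) \<Rightarrow> (nat \<Rightarrow> nat \<Rightarrow> 'w \<Rightarrow> 'x) \<Rightarrow> 'w \<Rightarrow> nat \<Rightarrow> nat \<Rightarrow> nat \<Rightarrow> real" where
  "dhat k X \<omega> n i j = sqrt ((1 / (real n)^2) * (\<Sum>l=1..n. \<Sum>m=1..n.
      k (X i l \<omega>) (X i m \<omega>) + k (X j l \<omega>) (X j m \<omega>) - 2 * k (X i l \<omega>) (X j m \<omega>)))"

text \<open>sel n \<delta> is the (tie-broken) SLINK output used at time n.\<close>
definition stop_time :: "('x \<Rightarrow> 'x \<Rightarrow> real) \<Rightarrow> (nat \<Rightarrow> nat \<Rightarrow> 'w \<Rightarrow> 'x) \<Rightarrow>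
    (nat \<Rightarrow> (nat \<Rightarrow> nat \<Rightarrow> real) \<Rightarrow> nat set set) \<Rightarrow> real \<Rightarrow> 'w \<Rightarrow> enat" where
  "stop_time k X sel C \<omega> =
    (let cond = (\<lambda>n. 2 \<le> n \<and> C / sqrt (real n) \<le> gamma (dhat k X \<omega> n) (sel n (dhat k X \<omega> n)))
     in if \<exists>n. cond n then enat (LEAST n. cond n) else \<infinity>)"

definition err_prob :: "'w measure \<Rightarrow> ('x \<Rightarrow> 'x \<Rightarrow> real) \<Rightarrow> (nat \<Rightarrow> nat \<Rightarrow> 'w \<Rightarrow> 'x) \<Rightarrow>
    (nat \<Rightarrow> (nat \<Rightarrow> nat \<Rightarrow> real) \<Rightarrow> nat set set) \<Rightarrow> nat set set \<Rightarrow> real \<Rightarrow> real" where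
  "err_prob \<Omega> k X sel P C = measure \<Omega> {\<omega> \<in> space \<Omega>.
      (case stop_time k X sel C \<omega> of enat n \<Rightarrow> sel n (dhat k X \<omega> n) \<noteq> P | \<infinity> \<Rightarrow> True)}"

definition neglog :: "real \<Rightarrow> ennreal" where
  "neglog q = (if q \<le> 0 then \<top> else ennreal (- ln q))"

end

theory Submission
  imports Defs "HOL-Real_Asymp.Real_Asymp"
begin

text \<open>It suffices to show \<open>E[N] \<le> a C\<^sup>2\<close> and \<open>P\<^sub>e \<le> exp (- b C\<^sup>2)\<close> for large \<open>C\<close>, with constants \<open>a, b > 0\<close>.
  Both follow once, for a fixed \<open>\<epsilon>\<close>, the event \<open>B\<^sub>n\<close> that some estimate \<open>dhat(i,j,n)\<close> is
  \<open>\<epsilon>\<close>-far from \<open>d(i,j)\<close> has exponentially small probability. Outside \<open>B\<^sub>n\<close> SLINK returns the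
  true clusters and \<open>\<Gamma>\<^sub>n \<ge> d\<^sub>H / 2\<close>, so \<open>N > n \<ge> 4 C\<^sup>2 / d\<^sub>H\<^sup>2\<close> forces \<open>B\<^sub>n\<close>. Conversely
  \<open>dhat \<le> sqrt (2 G)\<close>, so the test never stops before \<open>C\<^sup>2 / (2 G)\<close> and an error lies in the union of
  the \<open>B\<^sub>n\<close> with \<open>n \<ge> C\<^sup>2 / (2 G)\<close>.

  For the concentration, \<open>dhat\<^sup>2\<close> is a combination of V-statistics. The index square is cut into \<open>n\<close>
  antidiagonals modulo \<open>n\<close>; along each of them the summands depend on disjoint pairs of samples, so
  Hoeffding's inequality and a union bound over the antidiagonals apply. The limit is identified with
  the MMD by comparing both with a single sample on which all the relevant averages are accurate.\<close>

section \<open>Single linkage clustering\<close>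

lemma is_partition_finite:
  assumes "is_partition M K P"
  shows "finite P" "A \<in> P \<Longrightarrow> finite A" "A \<in> P \<Longrightarrow> i \<in> A \<Longrightarrow> i < M"
proof -
  have "P \<subseteq> Pow {..<M}" using assms by (auto simp: is_partition_def)
  then show "finite P" "A \<in> P \<Longrightarrow> finite A" "A \<in> P \<Longrightarrow> i \<in> A \<Longrightarrow> i < M"
    by (auto intro: finite_subset)
qed

lemma is_partition_disjoint:
  assumes "is_partition M K P" "A \<in> P" "B \<in> P" "i \<in> A" "i \<in> B"
  shows "A = B"
  using assms unfolding is_partition_def by blast

lemma linkage_le:
  assumes "finite A" "finite B" "i \<in> A" "j \<in> B"
  shows "linkage \<delta> A B \<le> \<delta> i j"
  unfolding linkage_def
proof (rule Min_le)
  have "{\<delta> i j |i j. i \<in> A \<and> j \<in> B} = (\<lambda>(i, j). \<delta> i j) ` (A \<times> B)" by auto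
  then show "finite {\<delta> i j |i j. i \<in> A \<and> j \<in> B}" using assms by simp
qed (use assms in auto)

lemma linkage_attained:
  assumes "finite A" "finite B" "A \<noteq> {}" "B \<noteq> {}"
  obtains i j where "i \<in> A" "j \<in> B" "linkage \<delta> A B = \<delta> i j"
proof -
  have eq: "{\<delta> i j |i j. i \<in> A \<and> j \<in> B} = (\<lambda>(i, j). \<delta> i j) ` (A \<times> B)" by auto
  have "Min {\<delta> i j |i j. i \<in> A \<and> j \<in> B} \<in> {\<delta> i j |i j. i \<in> A \<and> j \<in> B}"
    by (rule Min_in) (use assms in \<open>auto simp: eq\<close>)
  then show ?thesis using that by (auto simp: linkage_def)
qed

lemma finite_linkages: "finite P \<Longrightarrow> finite {linkage \<delta> A B |A B. A \<in> P \<and> B \<in> P \<and> A \<noteq> B}"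
  by (rule finite_subset[of _ "(\<lambda>(A, B). linkage \<delta> A B) ` (P \<times> P)"]) auto

lemma gamma_le:
  assumes "is_partition M K P" "A \<in> P" "B \<in> P" "A \<noteq> B" "i \<in> A" "j \<in> B"
  shows "gamma \<delta> P \<le> \<delta> i j"
proof -
  have "gamma \<delta> P \<le> linkage \<delta> A B"
    unfolding gamma_def using assms finite_linkages[OF is_partition_finite(1)[OF assms(1)]]
    by (intro Min_le) auto
  also have "\<dots> \<le> \<delta> i j"
    by (rule linkage_le) (use assms is_partition_finite in auto)
  finally show ?thesis .
qed

lemma two_clusters:
  assumes "is_partition M K P" "2 \<le> K"
  obtains A B where "A \<in> P" "B \<in> P" "A \<noteq> B"
proof -
  have "\<not> card P \<le> Suc 0" using assms by (auto simp: is_partition_def)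
  then show ?thesis
    using that is_partition_finite(1)[OF assms(1)] card_le_Suc0_iff_eq by blast
qed

lemma gamma_attained:
  assumes "is_partition M K P" "2 \<le> K"
  obtains A B i j where "A \<in> P" "B \<in> P" "A \<noteq> B" "i \<in> A" "j \<in> B" "gamma \<delta> P = \<delta> i j"
proof -
  obtain A B where "A \<in> P" "B \<in> P" "A \<noteq> B" using two_clusters[OF assms] by metis
  then have "gamma \<delta> P \<in> {linkage \<delta> A B |A B. A \<in> P \<and> B \<in> P \<and> A \<noteq> B}"
    unfolding gamma_def using finite_linkages[OF is_partition_finite(1)[OF assms(1)]]
    by (intro Min_in) auto
  then obtain A' B' where *: "A' \<in> P" "B' \<in> P" "A' \<noteq> B'" "gamma \<delta> P = linkage \<delta> A' B'" by auto
  have "A' \<noteq> {}" "B' \<noteq> {}" using * assms by (auto simp: is_partition_def)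
  then obtain i j where "i \<in> A'" "j \<in> B'" "linkage \<delta> A' B' = \<delta> i j"
    using linkage_attained[of A' B' \<delta>] is_partition_finite(2)[OF assms(1)] * by metis
  then show ?thesis using that * by metis
qed

text \<open>The count drops by exactly one because \<open>A \<union> B\<close> is not already a
  block: it meets the nonempty block \<open>A\<close>, so disjointness would force it to equal
  \<open>A\<close>.\<close>

lemma is_partition_merge:
  assumes P: "is_partition M n Cs" and AB: "A \<in> Cs" "B \<in> Cs" "A \<noteq> B"
  shows "is_partition M (n - 1) (insert (A \<union> B) (Cs - {A, B}))"
proof -
  have fin: "finite Cs" using is_partition_finite(1)[OF P] .
  have ne: "A \<noteq> {}" using P AB by (auto simp: is_partition_def)
  have "A \<union> B \<notin> Cs - {A, B}"
    using is_partition_disjoint[OF P] AB ne by blast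
  then have "card (insert (A \<union> B) (Cs - {A, B})) = Suc (card (Cs - {A, B}))"
    using fin by simp
  also have "\<dots> = Suc (card Cs - 2)"
    using AB fin by (simp add: card_Diff_subset)
  also have "\<dots> = n - 1"
  proof -
    have "card {A, B} \<le> card Cs" by (rule card_mono) (use AB fin in auto)
    then show ?thesis using AB P by (simp add: is_partition_def)
  qed
  finally have "card (insert (A \<union> B) (Cs - {A, B})) = n - 1" .
  moreover have "\<Union> (insert (A \<union> B) (Cs - {A, B})) = {..<M}"
    using P AB by (auto simp: is_partition_def)
  moreover have "X \<inter> Y = {}"
    if "X \<in> insert (A \<union> B) (Cs - {A, B})" "Y \<in> insert (A \<union> B) (Cs - {A, B})" "X \<noteq> Y" for X Y
  proof -
    have "x \<in> X \<Longrightarrow> x \<notin> Y" for x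
      using that is_partition_disjoint[OF P, of X Y x] is_partition_disjoint[OF P, of X A x]
        is_partition_disjoint[OF P, of X B x] is_partition_disjoint[OF P, of Y A x]
        is_partition_disjoint[OF P, of Y B x] AB by auto
    then show ?thesis by auto
  qed
  ultimately show ?thesis
    using P ne unfolding is_partition_def by auto
qed

text \<open>A merge removes exactly one block and happens only above \<open>K\<close>, so a run
  started with at least \<open>K\<close> blocks cannot overshoot and ends with exactly
  \<open>K\<close>.\<close>

lemma slink_run_partition:
  assumes "slink_run \<delta> K Cs R" "is_partition M n Cs" "K \<le> n"
  shows "is_partition M K R"
  using assms
proof (induction arbitrary: n rule: slink_run.induct)
  case (finished Cs)
  then show ?case by (auto simp: is_partition_def)
next
  case (merge_step Cs A B R)
  have "K \<le> n - 1" using merge_step.hyps(1) merge_step.prems(1) by (simp add: is_partition_def)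
  then show ?case
    using merge_step.IH[OF is_partition_merge[OF merge_step.prems(1) merge_step.hyps(2-4)]] by simp
qed

text \<open>Sending each block of \<open>Cs\<close> to the block of \<open>P\<close> around it is
  surjective, since both families cover the same set. With no more blocks in \<open>Cs\<close> than
  in \<open>P\<close> it is also injective, so every block of \<open>P\<close> consists of a single
  block of \<open>Cs\<close>.\<close>

lemma refinement_eqI:
  assumes Cs: "is_partition M n Cs" and P: "is_partition M K P"
    and ref: "\<forall>C\<in>Cs. \<exists>A\<in>P. C \<subseteq> A" and le: "n \<le> K"
  shows "Cs = P"
proof -
  obtain f where f: "\<And>C. C \<in> Cs \<Longrightarrow> f C \<in> P \<and> C \<subseteq> f C" using ref by metis
  have fin: "finite Cs" "finite P" using is_partition_finite Cs P by auto
  have hit: "\<exists>C\<in>Cs. f C = A \<and> a \<in> C" if A: "A \<in> P" "a \<in> A" for a A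
  proof -
    have "a \<in> \<Union>Cs" using A P Cs by (auto simp: is_partition_def)
    then obtain C where "C \<in> Cs" "a \<in> C" by auto
    then show ?thesis using f[of C] is_partition_disjoint[OF P _ _ A(2)] A by blast
  qed
  have surj: "f ` Cs = P"
  proof
    show "f ` Cs \<subseteq> P" using f by auto
    show "P \<subseteq> f ` Cs"
    proof
      fix A assume A: "A \<in> P"
      then obtain a where "a \<in> A" using P unfolding is_partition_def by blast
      then show "A \<in> f ` Cs" using hit[OF A] by auto
    qed
  qed
  have "inj_on f Cs"
  proof (rule eq_card_imp_inj_on[OF fin(1)])
    show "card (f ` Cs) = card Cs"
      using surj le card_image_le[OF fin(1), of f] P Cs by (simp add: is_partition_def)
  qed
  then have "A \<in> Cs" if "A \<in> P" for A
  proof -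
    obtain a where a: "a \<in> A" using \<open>A \<in> P\<close> P unfolding is_partition_def by blast
    obtain C where C: "C \<in> Cs" "f C = A" using hit[OF \<open>A \<in> P\<close> a] by auto
    have "A \<subseteq> C" using hit[OF \<open>A \<in> P\<close>] \<open>inj_on f Cs\<close> C by (metis inj_onD subsetI)
    then show ?thesis using f[OF C(1)] C by auto
  qed
  then show ?thesis
    using card_seteq[OF fin(1), of P] Cs P le by (auto simp: is_partition_def)
qed

text \<open>The invariant is that the current clusters refine \<open>P\<close>. Above
  \<open>K\<close> clusters, some cluster is a proper part of a block of \<open>P\<close>, and
  \<open>conn\<close> links it below \<tau> to the rest of that block. The minimal linkage is
  therefore below \<tau>, and by \<open>sep\<close> the two merged clusters lie in one block, so
  refinement survives. At \<open>K\<close> clusters \<open>refinement_eqI\<close> applies.\<close>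

lemma slink_run_correct:
  assumes "slink_run \<delta> K Cs R" "is_partition M n Cs" "is_partition M K P"
    and "\<forall>C\<in>Cs. \<exists>A\<in>P. C \<subseteq> A"
    and sep: "\<And>A B i j. A \<in> P \<Longrightarrow> B \<in> P \<Longrightarrow> A \<noteq> B \<Longrightarrow> i \<in> A \<Longrightarrow> j \<in> B \<Longrightarrow> \<tau> \<le> \<delta> i j"
    and conn: "\<And>A B. A \<in> P \<Longrightarrow> B \<subset> A \<Longrightarrow> B \<noteq> {} \<Longrightarrow> \<exists>i\<in>B. \<exists>j\<in>A - B. \<delta> i j < \<tau>"
  shows "R = P"
  using assms(1-4)
proof (induction arbitrary: n rule: slink_run.induct)
  case (finished Cs)
  then show ?case by (intro refinement_eqI) (auto simp: is_partition_def)
next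
  case (merge_step Cs A B R)
  note Cs = merge_step.prems(1) and P = merge_step.prems(2) and ref = merge_step.prems(3)
  note fin = is_partition_finite[OF Cs]
  \<comment> \<open>There are more current clusters than blocks, so not all clusters can be complete
    blocks.\<close>
  have "\<not> Cs \<subseteq> P"
    using card_mono[of P Cs] merge_step.hyps(1) is_partition_finite(1)[OF P] P
    by (auto simp: is_partition_def)
  then obtain C where C: "C \<in> Cs" "C \<notin> P" by auto
  then obtain Q where Q: "Q \<in> P" "C \<subset> Q" using ref by (metis psubsetI)
  have "C \<noteq> {}" using C Cs by (auto simp: is_partition_def)
  then obtain i j where ij: "i \<in> C" "j \<in> Q - C" "\<delta> i j < \<tau>" using conn[OF Q] by auto
  have "j \<in> \<Union>Cs" using ij Q P Cs by (auto simp: is_partition_def)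
  then obtain C' where C': "C' \<in> Cs" "j \<in> C'" by auto
  have "linkage \<delta> A B \<le> linkage \<delta> C C'"
    using merge_step.hyps(5) C C' ij by auto
  also have "\<dots> \<le> \<delta> i j" by (rule linkage_le) (use fin C C' ij in auto)
  finally have lt: "linkage \<delta> A B < \<tau>" using ij by simp
  have "A \<noteq> {}" "B \<noteq> {}" using merge_step.hyps Cs by (auto simp: is_partition_def)
  then obtain a b where ab: "a \<in> A" "b \<in> B" "linkage \<delta> A B = \<delta> a b"
    using linkage_attained[of A B \<delta>] fin merge_step.hyps by metis
  obtain QA QB where q: "QA \<in> P" "A \<subseteq> QA" "QB \<in> P" "B \<subseteq> QB"
    using ref merge_step.hyps by metis
  have "QA = QB"
    using sep[of QA QB a b] q ab lt by fastforce
  then have "\<forall>C\<in>insert (A \<union> B) (Cs - {A, B}). \<exists>A\<in>P. C \<subseteq> A"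
    using ref q by auto
  then show ?case
    using merge_step.IH[OF is_partition_merge[OF Cs merge_step.hyps(2-4)] P] by blast
qed

lemma is_partition_singletons: "is_partition M M ((\<lambda>i. {i}) ` {..<M})"
  unfolding is_partition_def by (auto simp: card_image inj_on_def)

lemma is_partition_card_le:
  assumes "is_partition M K P"
  shows "K \<le> M"
proof -
  obtain f where f: "\<And>A. A \<in> P \<Longrightarrow> f A \<in> A"
    using assms unfolding is_partition_def by (metis all_not_in_conv)
  have "inj_on f P" by (metis inj_onI f is_partition_disjoint[OF assms])
  moreover have "f ` P \<subseteq> {..<M}" using f is_partition_finite(3)[OF assms] by auto
  ultimately have "card P \<le> card {..<M}" by (intro card_inj_on_le) auto
  then show ?thesis using assms by (simp add: is_partition_def)
qed

lemma slink_out_partition: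
  assumes "slink_out \<delta> M K R" "K \<le> M"
  shows "is_partition M K R"
  using assms slink_run_partition[OF _ is_partition_singletons] by (auto simp: slink_out_def)

text \<open>The value of \<open>gamma\<close> is attained at one pair of indices. Combined with a
  uniform bound on the estimates, this keeps the test from stopping early.\<close>

lemma slink_out_gamma_le:
  assumes "slink_out \<delta> M K R" "K \<le> M" "2 \<le> K" 
    and "\<And>i j. i < M \<Longrightarrow> j < M \<Longrightarrow> \<delta> i j \<le> b"
  shows "gamma \<delta> R \<le> b"
proof -
  have R: "is_partition M K R" using slink_out_partition assms by blast
  show ?thesis
    using gamma_attained[OF R assms(3), of \<delta>] assms(4) is_partition_finite(3)[OF R] by metis
qed

section \<open>Intra-cluster connectivity and inter-cluster separation\<close>

text \<open>The sets \<open>B\<close> and \<open>A - B\<close> form one of the splits over which the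
  maximum in \<open>d_I_cluster\<close> is taken. This is the connectivity that
  \<open>slink_run_correct\<close> asks for.\<close>

lemma d_I_ge_split:
  assumes P: "is_partition M K P" and A: "A \<in> P" "B \<subset> A" "B \<noteq> {}"
  obtains i j where "i \<in> B" "j \<in> A - B" "d i j \<le> d_I d P"
proof -
  have fin: "finite A" "finite P" using is_partition_finite[OF P] A by auto
  then have finB: "finite B" using A by (auto intro: finite_subset)
  have "A - B \<noteq> {}" using A by auto
  then obtain i j where ij: "i \<in> B" "j \<in> A - B" "linkage d B (A - B) = d i j"
    using linkage_attained[of B "A - B" d] fin finB A by (metis finite_Diff)
  have "\<not> card A \<le> 1"
  proof
    assume "card A \<le> 1"
    then have "i = j" using ij A fin card_le_Suc0_iff_eq[of A] by auto
    then show False using ij by auto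
  qed
  moreover have "linkage d B (A - B) \<le> Max {linkage d B (A - B) | B. B \<subseteq> A \<and> B \<noteq> {} \<and> B \<noteq> A}"
    by (rule Max_ge) (use fin A in auto)
  ultimately have "d i j \<le> d_I_cluster d A" using ij by (simp add: d_I_cluster_def)
  also have "\<dots> \<le> d_I d P" unfolding d_I_def using fin A by (intro Max_ge) auto
  finally show ?thesis using that ij by metis
qed

text \<open>Serves to turn the gap between \<open>d_I\<close> and \<open>d_H\<close> into positivity
  of \<open>d_H\<close>. Nonnegativity of \<open>d\<close> is asked off the diagonal only, which is
  all that a linkage between disjoint sets evaluates.\<close>

lemma d_I_nonneg:
  assumes P: "is_partition M K P" "2 \<le> K" and d: "\<And>i j. i < M \<Longrightarrow> j < M \<Longrightarrow> i \<noteq> j \<Longrightarrow> 0 \<le> d i j"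
  shows "0 \<le> d_I d P"
proof -
  obtain A where A: "A \<in> P" using two_clusters[OF P] by metis
  show ?thesis
  proof (cases "card A \<le> 1")
    case True
    then have "0 = d_I_cluster d A" by (simp add: d_I_cluster_def)
    also have "\<dots> \<le> d_I d P"
      unfolding d_I_def using is_partition_finite(1)[OF P(1)] A by (intro Max_ge) auto
    finally show ?thesis .
  next
    case False
    then obtain a b where "a \<in> A" "b \<in> A" "a \<noteq> b"
      using is_partition_finite(2)[OF P(1) A] by (auto simp: card_le_Suc0_iff_eq)
    then have "{a} \<subset> A" "{a} \<noteq> {}" by auto
    then obtain i j where ij: "i \<in> {a}" "j \<in> A - {a}" "d i j \<le> d_I d P"
      using d_I_ge_split[OF P(1) A, of "{a}" d] by metis
    then have "i < M" "j < M" "i \<noteq> j"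
      using is_partition_finite(3)[OF P(1) A] \<open>a \<in> A\<close> by auto
    then show ?thesis using d[of i j] ij by simp
  qed
qed

text \<open>The threshold is \<open>d_H d P - \<epsilon>\<close>: estimates between different blocks
  stay at or above it, while every split of a block is bridged by an estimate below
  \<open>d_I d P + \<epsilon>\<close>, which by \<open>gap\<close> does not exceed it.\<close>

lemma slink_out_correct:
  assumes P: "is_partition M K P" and "2 \<le> K"
    and close: "\<And>i j. i < M \<Longrightarrow> j < M \<Longrightarrow> i \<noteq> j \<Longrightarrow> \<bar>\<delta> i j - d i j\<bar> < \<epsilon>"
    and gap: "d_I d P + 2 * \<epsilon> \<le> d_H d P"
    and R: "slink_out \<delta> M K R"
  shows "R = P" and "d_H d P - \<epsilon> \<le> gamma \<delta> R"
proof -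
  have sep: "d_H d P - \<epsilon> \<le> \<delta> i j"
    if "A \<in> P" "B \<in> P" "A \<noteq> B" "i \<in> A" "j \<in> B" for A B i j
  proof -
    have "i < M" "j < M" "i \<noteq> j"
      using that is_partition_finite(3)[OF P] is_partition_disjoint[OF P] by blast+
    moreover have "d_H d P \<le> d i j" unfolding d_H_def by (rule gamma_le[OF P]) fact+
    ultimately show ?thesis using close[of i j] by auto
  qed
  have "\<exists>i\<in>B. \<exists>j\<in>A - B. \<delta> i j < d_H d P - \<epsilon>" if A: "A \<in> P" "B \<subset> A" "B \<noteq> {}" for A B
  proof -
    obtain i j where ij: "i \<in> B" "j \<in> A - B" "d i j \<le> d_I d P"
      using d_I_ge_split[OF P A] by metis
    then have "i < M" "j < M" "i \<noteq> j"
      using A is_partition_finite(3)[OF P, of A] by blast+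
    then show ?thesis using close[of i j] ij gap by (intro bexI[of _ i] bexI[of _ j]) auto
  qed
  moreover have "\<forall>C\<in>(\<lambda>i. {i}) ` {..<M}. \<exists>A\<in>P. C \<subseteq> A"
    using P by (auto simp: is_partition_def)
  ultimately show "R = P"
    using R unfolding slink_out_def
    by (intro slink_run_correct[where \<tau> = "d_H d P - \<epsilon>", OF _ is_partition_singletons P _ sep])
  then show "d_H d P - \<epsilon> \<le> gamma \<delta> R"
    using gamma_attained[OF P \<open>2 \<le> K\<close>, of \<delta>] sep by metis
qed

section \<open>Finite kernel expansions and the unit ball\<close>

text \<open>The inner product of the pre-Hilbert space of finite expansions, with
  \<open>knorm2\<close> as its squared norm.\<close>

definition kform :: "('x \<Rightarrow> 'x \<Rightarrow> real) \<Rightarrow> (real \<times> 'x) list \<Rightarrow> (real \<times> 'x) list \<Rightarrow> real" where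
  "kform k ps qs = (\<Sum>(c,x)\<leftarrow>ps. \<Sum>(c',x')\<leftarrow>qs. c * c' * k x x')"

definition kscale :: "real \<Rightarrow> (real \<times> 'x) list \<Rightarrow> (real \<times> 'x) list" where
  "kscale t = map (\<lambda>(c,x). (t * c, x))"

lemma knorm2_eq_kform: "knorm2 k ps = kform k ps ps"
  by (simp add: knorm2_def kform_def)

lemma sum_list_pair_add:
  "(\<Sum>(c,x)\<leftarrow>ps. f c x + g c x) = (\<Sum>(c,x)\<leftarrow>ps. f c x) + (\<Sum>(c,x)\<leftarrow>ps. (g c x :: real))"
  by (induction ps) auto

lemma sum_list_pair_cmult:
  "(\<Sum>(c,x)\<leftarrow>ps. t * f c x) = t * (\<Sum>(c,x)\<leftarrow>ps. (f c x :: real))"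
  by (induction ps) (auto simp: algebra_simps)

lemma kform_append_left: "kform k (ps @ ps') qs = kform k ps qs + kform k ps' qs"
  by (simp add: kform_def)

lemma kform_Nil [simp]: "kform k [] qs = 0" "kform k ps [] = 0"
  by (simp_all add: kform_def case_prod_unfold)

lemma kform_Cons_left: "kform k ((c,x) # ps) qs = c * (\<Sum>(c',x')\<leftarrow>qs. c' * k x x') + kform k ps qs"
  by (simp add: kform_def mult.assoc sum_list_pair_cmult)

lemma kform_Cons_right: "kform k ps ((c,y) # qs) = c * kfun k ps y + kform k ps qs"
proof -
  have "kform k ps ((c,y) # qs) = (\<Sum>(c',x)\<leftarrow>ps. c * (c' * k x y)) + kform k ps qs"
    by (simp add: kform_def sum_list_pair_add[symmetric] mult_ac)
  then show ?thesis by (simp add: kfun_def sum_list_pair_cmult)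
qed

text \<open>The reproducing property: pairing with an expansion evaluates the function at the points
  of that expansion.\<close>

lemma kform_eq_sum_kfun: "kform k ps qs = (\<Sum>(c,y)\<leftarrow>qs. c * kfun k ps y)"
  by (induction qs) (auto simp: kform_Cons_right)

lemma kform_sym:
  assumes "pd_kernel k"
  shows "kform k ps qs = kform k qs ps"
proof (induction ps)
  case (Cons p ps)
  obtain c x where "p = (c, x)" by force
  moreover have "k x y = k y x" for x y using assms by (simp add: pd_kernel_def)
  then have "(\<Sum>(c',x')\<leftarrow>qs. c' * k x x') = kfun k qs x" by (simp add: kfun_def)
  ultimately show ?case using Cons by (simp add: kform_Cons_left kform_Cons_right)
qed simp

lemma kform_append_right: "kform k ps (qs @ qs') = kform k ps qs + kform k ps qs'"
  by (simp add: kform_eq_sum_kfun)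

lemma kform_scale_right: "kform k ps (kscale t qs) = t * kform k ps qs"
  by (induction qs) (auto simp: kform_Cons_right kscale_def algebra_simps)

lemma kform_scale_left: "kform k (kscale t ps) qs = t * kform k ps qs"
  by (induction ps) (auto simp: kform_Cons_left kscale_def algebra_simps)

lemma kfun_scale: "kfun k (kscale t ps) y = t * kfun k ps y"
  by (induction ps) (auto simp: kfun_def kscale_def algebra_simps)

lemma knorm2_nonneg: "pd_kernel k \<Longrightarrow> 0 \<le> knorm2 k ps"
  by (simp add: pd_kernel_def)

lemma kform_Cauchy_Schwarz:
  assumes "pd_kernel k"
  shows "\<bar>kform k ps qs\<bar> \<le> sqrt (knorm2 k ps) * sqrt (knorm2 k qs)"
proof -
  let ?a = "knorm2 k ps" and ?b = "kform k ps qs" and ?c = "knorm2 k qs"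
  \<comment> \<open>This is the squared norm of \<open>s\<close> times \<open>ps\<close> plus
    \<open>t\<close> times \<open>qs\<close>.\<close>
  have nonneg: "0 \<le> s\<^sup>2 * ?a + 2 * s * t * ?b + t\<^sup>2 * ?c" for s t
    using knorm2_nonneg[OF assms, of "kscale s ps @ kscale t qs"] kform_sym[OF assms, of qs ps]
    by (simp add: knorm2_eq_kform kform_append_left kform_append_right kform_scale_left
        kform_scale_right power2_eq_square algebra_simps)
  have a: "0 \<le> ?a" using knorm2_nonneg[OF assms] .
  have "?b\<^sup>2 \<le> ?a * ?c"
  proof (cases "?a = 0")
    case True
    have "?b = 0"
    proof (rule ccontr)
      assume "?b \<noteq> 0"
      \<comment> \<open>The form may vanish on nonzero expansions, so this case is genuine. With
        \<open>?a = 0\<close> and \<open>t = 1\<close>, the chosen \<open>s\<close> makes the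
        quadratic form equal to -1.\<close>
      then show False
        using nonneg[of "- (?c + 1) / (2 * ?b)" 1] True by (simp add: field_simps)
    qed
    then show ?thesis using True by simp
  next
    case False
    \<comment> \<open>With \<open>s = - ?b\<close> and \<open>t = ?a\<close> the quadratic form
      factors in this way.\<close>
    have "0 \<le> ?a * (?a * ?c - ?b\<^sup>2)"
      using nonneg[of "- ?b" ?a] by (simp add: power2_eq_square algebra_simps)
    then show ?thesis using False a by (simp add: zero_le_mult_iff)
  qed
  then have "sqrt (?b\<^sup>2) \<le> sqrt (?a * ?c)" by (rule real_sqrt_le_mono)
  then show ?thesis by (simp add: real_sqrt_mult)
qed

lemma tendsto_sum_list_pair:
  assumes "\<And>y. (\<lambda>n. h n y) \<longlonglongrightarrow> (f y :: real)"
  shows "(\<lambda>n. \<Sum>(c,y)\<leftarrow>qs. c * h n y) \<longlonglongrightarrow> (\<Sum>(c,y)\<leftarrow>qs. c * f y)"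
proof (induction qs)
  case (Cons q qs)
  then show ?case by (cases q) (auto intro!: tendsto_intros assms)
qed simp

text \<open>The sum is the inner product of \<open>f\<close> with the expansion \<open>qs\<close>.
  Cauchy-Schwarz bounds it for the approximating expansions, and the bound passes to the limit,
  where their norms tend to some \<open>L \<le> 1\<close>.\<close>

lemma rkhs_unit_ball_bound:
  assumes k: "pd_kernel k" and f: "f \<in> rkhs_unit_ball k"
  shows "\<bar>\<Sum>(c,y)\<leftarrow>qs. c * f y\<bar> \<le> sqrt (knorm2 k qs)"
proof -
  from f obtain g L where lim: "\<And>y. (\<lambda>n. kfun k (g n) y) \<longlonglongrightarrow> f y"
    and L: "L \<le> 1" "(\<lambda>n. sqrt (knorm2 k (g n))) \<longlonglongrightarrow> L"
    by (auto simp: rkhs_unit_ball_def)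
  have "(\<lambda>n. \<bar>kform k (g n) qs\<bar>) \<longlonglongrightarrow> \<bar>\<Sum>(c,y)\<leftarrow>qs. c * f y\<bar>"
    unfolding kform_eq_sum_kfun by (intro tendsto_rabs tendsto_sum_list_pair lim)
  moreover have "(\<lambda>n. sqrt (knorm2 k (g n)) * sqrt (knorm2 k qs)) \<longlonglongrightarrow> L * sqrt (knorm2 k qs)"
    by (intro tendsto_intros L)
  ultimately have "\<bar>\<Sum>(c,y)\<leftarrow>qs. c * f y\<bar> \<le> L * sqrt (knorm2 k qs)"
    by (rule LIMSEQ_le) (use kform_Cauchy_Schwarz[OF k] in auto)
  also have "\<dots> \<le> 1 * sqrt (knorm2 k qs)"
    using L knorm2_nonneg[OF k] by (intro mult_right_mono) auto
  finally show ?thesis by simp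
qed

lemma rkhs_unit_ball_abs_le:
  assumes "pd_kernel k" "f \<in> rkhs_unit_ball k"
  shows "\<bar>f x\<bar> \<le> sqrt (k x x)"
  using rkhs_unit_ball_bound[OF assms, of "[(1, x)]"] by (simp add: knorm2_def)

lemma kfun_in_rkhs_unit_ball:
  assumes k: "pd_kernel k" and "knorm2 k ps \<le> 1"
  shows "kfun k ps \<in> rkhs_unit_ball k"
proof -
  have "map (\<lambda>(c,x). (-c,x)) ps = kscale (- 1) ps" by (simp add: kscale_def)
  then have "knorm2 k (ps @ map (\<lambda>(c,x). (-c,x)) ps) = 0"
    by (simp add: knorm2_eq_kform kform_append_left kform_append_right kform_scale_left
        kform_scale_right)
  moreover have "sqrt (knorm2 k ps) \<le> 1" using assms by simp
  ultimately show ?thesis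
    unfolding rkhs_unit_ball_def
    by (intro CollectI exI[of _ "\<lambda>_. ps"] conjI exI[of _ "sqrt (knorm2 k ps)"]) auto
qed

lemma zero_in_rkhs_unit_ball: "pd_kernel k \<Longrightarrow> (\<lambda>_. 0) \<in> rkhs_unit_ball k"
  using kfun_in_rkhs_unit_ball[of k "[]"] by (simp add: knorm2_def kfun_def[abs_def])

section \<open>Empirical mean embeddings\<close>

text \<open>The difference of the empirical mean embeddings of two samples, as a finite expansion.
  Its norm is the estimate \<open>dhat\<close>.\<close>

definition empdiff :: "nat \<Rightarrow> (nat \<Rightarrow> 'x) \<Rightarrow> (nat \<Rightarrow> 'x) \<Rightarrow> (real \<times> 'x) list" where
  "empdiff n x y = map (\<lambda>l. (1 / real n, x l)) [1..<Suc n] @ map (\<lambda>l. (- 1 / real n, y l)) [1..<Suc n]"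

lemma sum_list_empdiff:
  "(\<Sum>(c,z)\<leftarrow>empdiff n x y. c * f z) = (\<Sum>l=1..n. f (x l)) / n - (\<Sum>l=1..n. f (y l)) / n"
proof -
  have "(\<Sum>l\<leftarrow>[1..<Suc n]. h l) = (\<Sum>l=1..n. h l)" for h :: "nat \<Rightarrow> real"
    by (simp only: sum_set_upt_conv_sum_list_nat[symmetric] set_upt atLeastLessThanSuc_atLeastAtMost)
  then show ?thesis
    unfolding empdiff_def map_append sum_list_append map_map comp_def prod.case
    by (simp only: sum_distrib_left[symmetric]) (simp add: field_simps)
qed

text \<open>Bilinearity produces four double sums. The two cross sums agree, one by symmetry of
  \<open>k\<close> and the other by exchanging the order of summation.\<close>

lemma knorm2_empdiff:
  assumes "pd_kernel k"
  shows "knorm2 k (empdiff n x y) = (1 / (real n)^2) * (\<Sum>l=1..n. \<Sum>m=1..n.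
      k (x l) (x m) + k (y l) (y m) - 2 * k (x l) (y m))"
proof -
  have sym: "k u v = k v u" for u v using assms by (simp add: pd_kernel_def)
  have kf: "kfun k (empdiff n x y) z = (\<Sum>l=1..n. k (x l) z) / n - (\<Sum>l=1..n. k (y l) z) / n" for z
    using sum_list_empdiff[of "\<lambda>u. k u z" n x y] by (simp add: kfun_def)
  have yx: "(\<Sum>l=1..n. \<Sum>m=1..n. k (y m) (x l)) = (\<Sum>l=1..n. \<Sum>m=1..n. k (x l) (y m))"
    by (simp add: sym[of "y _"])
  have yx': "(\<Sum>l=1..n. \<Sum>m=1..n. k (x m) (y l)) = (\<Sum>l=1..n. \<Sum>m=1..n. k (x l) (y m))"
    by (rule sum.swap)
  have xx: "(\<Sum>l=1..n. \<Sum>m=1..n. k (x m) (x l)) = (\<Sum>l=1..n. \<Sum>m=1..n. k (x l) (x m))" for x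
    by (rule sum.swap)
  show ?thesis
    unfolding knorm2_eq_kform kform_eq_sum_kfun sum_list_empdiff kf
    by (simp add: sum.distrib sum_subtractf sum_divide_distrib[symmetric] yx yx' xx
        sum_distrib_left[symmetric] power2_eq_square diff_divide_distrib add_divide_distrib
        del: One_nat_def)
qed

lemma dhat_eq_knorm2:
  "pd_kernel k \<Longrightarrow> dhat k X \<omega> n i j = sqrt (knorm2 k (empdiff n (\<lambda>l. X i l \<omega>) (\<lambda>l. X j l \<omega>)))"
  by (simp add: dhat_def knorm2_empdiff)

section \<open>Events of exponentially small probability\<close>

text \<open>For fixed \<open>c < n\<close> the map \<open>antidiag n c\<close> is the involution of \<open>{1..n}\<close> sending \<open>l\<close> to the
  \<open>m\<close> with \<open>l + m = c + 1\<close> modulo \<open>n\<close>; it splits \<open>{1..n}\<^sup>2\<close> into \<open>n\<close> sets of disjoint pairs.\<close>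
definition antidiag :: "nat \<Rightarrow> nat \<Rightarrow> nat \<Rightarrow> nat" where
  "antidiag n c l = (if l \<le> c then Suc c - l else Suc c + n - l)"

lemma antidiag_range: "c < n \<Longrightarrow> l \<in> {1..n} \<Longrightarrow> antidiag n c l \<in> {1..n}"
  by (auto simp: antidiag_def)

lemma antidiag_invol: "c < n \<Longrightarrow> l \<in> {1..n} \<Longrightarrow> antidiag n c (antidiag n c l) = l"
  by (auto simp: antidiag_def)

text \<open>For fixed \<open>l\<close>, the value \<open>antidiag n c l\<close> runs once through
  \<open>{1..n}\<close> as \<open>c\<close> runs through \<open>{..<n}\<close>; the inverse sends
  \<open>m\<close> to \<open>l + m - 1\<close> modulo \<open>n\<close>.\<close>

lemma sum_antidiag:
  fixes f :: "nat \<Rightarrow> nat \<Rightarrow> 'b::comm_monoid_add"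
  shows "(\<Sum>l=1..n. \<Sum>m=1..n. f l m) = (\<Sum>c<n. \<Sum>l=1..n. f l (antidiag n c l))"
proof -
  have "(\<Sum>m=1..n. f l m) = (\<Sum>c<n. f l (antidiag n c l))" if "l \<in> {1..n}" for l
    by (rule sum.reindex_bij_witness[where i = "\<lambda>c. antidiag n c l"
          and j = "\<lambda>m. if m + l \<le> n then m + l - 1 else m + l - 1 - n"])
      (use that in \<open>auto simp: antidiag_def\<close>)
  then have "(\<Sum>l=1..n. \<Sum>m=1..n. f l m) = (\<Sum>l=1..n. \<Sum>c<n. f l (antidiag n c l))"
    by (rule sum.cong[OF refl])
  also have "\<dots> = (\<Sum>c<n. \<Sum>l=1..n. f l (antidiag n c l))" by (rule sum.swap)
  finally show ?thesis .
qed

text \<open>Fixed points of \<sigma> contribute 0 by \<open>diag\<close>, and the two members of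
  each remaining orbit contribute equally by \<open>sym\<close>. Keeping the smaller member of each
  orbit leaves terms indexed by disjoint pairs.\<close>

lemma sum_involution_symmetric:
  fixes f :: "nat \<Rightarrow> nat \<Rightarrow> real"
  assumes \<sigma>: "\<And>l. l \<in> I \<Longrightarrow> \<sigma> l \<in> I" "\<And>l. l \<in> I \<Longrightarrow> \<sigma> (\<sigma> l) = l" and "finite I"
    and sym: "\<And>l m. f l m = f m l" and diag: "\<And>l. f l l = 0"
  shows "(\<Sum>l\<in>I. f l (\<sigma> l)) = 2 * (\<Sum>l\<in>{l\<in>I. l < \<sigma> l}. f l (\<sigma> l))"
proof -
  have "(\<Sum>l\<in>I. f l (\<sigma> l)) = (\<Sum>l\<in>{l\<in>I. l < \<sigma> l} \<union> {l\<in>I. \<sigma> l < l}. f l (\<sigma> l))"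
  proof (rule sum.mono_neutral_right)
    show "\<forall>l\<in>I - ({l \<in> I. l < \<sigma> l} \<union> {l \<in> I. \<sigma> l < l}). f l (\<sigma> l) = 0"
      using diag by (metis (mono_tags, lifting) DiffE UnI1 UnI2 linorder_neqE_nat mem_Collect_eq)
  qed (use assms in auto)
  also have "\<dots> = (\<Sum>l\<in>{l\<in>I. l < \<sigma> l}. f l (\<sigma> l)) + (\<Sum>l\<in>{l\<in>I. \<sigma> l < l}. f l (\<sigma> l))"
    by (rule sum.union_disjoint) (use assms in auto)
  also have "(\<Sum>l\<in>{l\<in>I. \<sigma> l < l}. f l (\<sigma> l)) = (\<Sum>l\<in>{l\<in>I. l < \<sigma> l}. f l (\<sigma> l))"
    by (rule sum.reindex_bij_witness[where i = \<sigma> and j = \<sigma>]) (use \<sigma> sym in auto)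
  finally show ?thesis by simp
qed

context prob_space
begin

text \<open>The set \<open>T\<close> may have fewer than \<open>n\<close> elements, because half an
  antidiagonal has varying size; fewer summands only improve the exponent at the same deviation
  \<open>n * \<epsilon>\<close>. The empty set is treated apart since Hoeffding's inequality
  requires a positive total squared width.\<close>

lemma Hoeffding_uniform:
  fixes Y :: "'b \<Rightarrow> 'a \<Rightarrow> real"
  assumes T: "finite T" "card T \<le> n" and ind: "indep_vars (\<lambda>_. borel) Y T"
    and bnd: "\<And>t \<omega>. t \<in> T \<Longrightarrow> \<omega> \<in> space M \<Longrightarrow> Y t \<omega> \<in> {a..b}"
    and mean: "\<And>t. t \<in> T \<Longrightarrow> expectation (Y t) = \<mu>"
    and pos: "0 < n" "0 < \<epsilon>" "a < b"
  shows "prob {\<omega>\<in>space M. real n * \<epsilon> \<le> \<bar>\<Sum>t\<in>T. (Y t \<omega> - \<mu>)\<bar>} \<le> 2 * exp (- 2 * real n * \<epsilon>\<^sup>2 / (b - a)\<^sup>2)"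
proof (cases "T = {}")
  case True
  then have "{\<omega>\<in>space M. real n * \<epsilon> \<le> \<bar>\<Sum>t\<in>T. (Y t \<omega> - \<mu>)\<bar>} = {}"
    using pos by (auto simp: not_le)
  then show ?thesis by (simp only: measure_empty) simp
next
  case False
  interpret H: Hoeffding_ineq M T Y "\<lambda>_. a" "\<lambda>_. b" "\<Sum>t\<in>T. expectation (Y t)"
    by unfold_locales (use T ind bnd in auto)
  have card: "0 < card T" using T False by (simp add: card_gt_0_iff)
  then have pos': "0 < (\<Sum>t\<in>T. (b - a)\<^sup>2)" using pos by simp
  have eq: "(\<Sum>t\<in>T. (Y t \<omega> - \<mu>)) = (\<Sum>t\<in>T. Y t \<omega>) - (\<Sum>t\<in>T. expectation (Y t))" for \<omega>
    using mean by (simp add: sum_subtractf)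
  have "prob {\<omega>\<in>space M. real n * \<epsilon> \<le> \<bar>\<Sum>t\<in>T. (Y t \<omega> - \<mu>)\<bar>}
      \<le> 2 * exp (- 2 * (real n * \<epsilon>)\<^sup>2 / (\<Sum>t\<in>T. (b - a)\<^sup>2))"
    unfolding eq by (rule H.Hoeffding_ineq_abs_ge) (use pos pos' in auto)
  also have "\<dots> \<le> 2 * exp (- 2 * real n * \<epsilon>\<^sup>2 / (b - a)\<^sup>2)"
  proof -
    have "2 * real n * \<epsilon>\<^sup>2 / (b - a)\<^sup>2 = 2 * (real n * \<epsilon>)\<^sup>2 / (real n * (b - a)\<^sup>2)"
      using pos by (simp add: power2_eq_square)
    also have "\<dots> \<le> 2 * (real n * \<epsilon>)\<^sup>2 / (\<Sum>t\<in>T. (b - a)\<^sup>2)"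
      using T pos card by (intro divide_left_mono) (auto intro!: mult_right_mono)
    finally show ?thesis by simp
  qed
  finally show ?thesis .
qed

section \<open>Calculus of exponentially small sequences of events\<close>

definition exp_small :: "(nat \<Rightarrow> 'a set) \<Rightarrow> bool" where
  "exp_small E \<longleftrightarrow> (\<forall>n. E n \<in> events) \<and> (\<exists>A c. 0 < c \<and> (\<forall>n. prob (E n) \<le> A * exp (- c * real n)))"

text \<open>Half of the rate absorbs the factor \<open>n\<close> left by a union bound, through
  \<open>real n \<le> 2 / c * exp (c / 2 * real n)\<close>. For \<open>n\<close> below
  \<open>N\<close> the trivial bound 1 is absorbed by the constant
  \<open>exp (c / 2 * real N)\<close>.\<close>

lemma exp_smallI:
  assumes E: "\<And>n. E n \<in> events" and c: "0 < c" and "0 \<le> A"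
    and le: "\<And>n. N \<le> n \<Longrightarrow> prob (E n) \<le> A * real n * exp (- c * real n)"
  shows "exp_small E"
  unfolding exp_small_def
proof (intro conjI allI exI)
  show "0 < c / 2" using c by simp
  show "prob (E n) \<le> (exp (c / 2 * real N) + 2 * A / c) * exp (- (c / 2) * real n)" for n
  proof (cases "N \<le> n")
    case True
    have "real n \<le> 2 / c * exp (c / 2 * real n)"
      using exp_ge_add_one_self[of "c / 2 * real n"] c by (simp add: field_simps)
    then have "A * real n * exp (- c * real n) \<le> A * (2 / c * exp (c / 2 * real n)) * exp (- c * real n)"
      using \<open>0 \<le> A\<close> by (intro mult_right_mono mult_left_mono) auto
    also have "\<dots> = 2 * A / c * exp (- (c / 2) * real n)"
      by (simp add: exp_add[symmetric] mult.assoc)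
    also have "\<dots> \<le> (exp (c / 2 * real N) + 2 * A / c) * exp (- (c / 2) * real n)"
      by (intro mult_right_mono) auto
    finally show ?thesis using le[OF True] by simp
  next
    case False
    have "prob (E n) \<le> 1" by simp
    also have "1 \<le> exp (c / 2 * real N) * exp (- (c / 2) * real n)"
      using False c by (simp add: exp_add[symmetric])
    also have "\<dots> \<le> (exp (c / 2 * real N) + 2 * A / c) * exp (- (c / 2) * real n)"
      using c \<open>0 \<le> A\<close> by (intro mult_right_mono) auto
    finally show ?thesis .
  qed
qed (use E in auto)

lemma exp_smallE:
  assumes "exp_small E"
  obtains A c where "0 < c" "0 \<le> A" "\<And>n. prob (E n) \<le> A * exp (- c * real n)"
proof -
  obtain A c where *: "0 < c" "\<And>n. prob (E n) \<le> A * exp (- c * real n)"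
    using assms by (auto simp: exp_small_def)
  have "0 \<le> A * exp (- c * real 0)" using *(2)[of 0] measure_nonneg[of M "E 0"] by linarith
  then show ?thesis using that * by simp
qed

lemma exp_small_events: "exp_small E \<Longrightarrow> E n \<in> events"
  by (simp add: exp_small_def)

lemma exp_small_empty: "exp_small (\<lambda>_. {})"
  by (rule exp_smallI[of _ 1 0 0]) auto

lemma exp_small_Un:
  assumes "exp_small E" "exp_small F"
  shows "exp_small (\<lambda>n. E n \<union> F n)"
proof -
  obtain A c where A: "0 < c" "0 \<le> A" "\<And>n. prob (E n) \<le> A * exp (- c * real n)"
    using exp_smallE[OF assms(1)] by metis
  obtain B d where B: "0 < d" "0 \<le> B" "\<And>n. prob (F n) \<le> B * exp (- d * real n)"
    using exp_smallE[OF assms(2)] by metis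
  show ?thesis
  proof (rule exp_smallI[of _ "min c d" "A + B" 1])
    fix n :: nat assume n: "1 \<le> n"
    have "prob (E n \<union> F n) \<le> prob (E n) + prob (F n)"
      using assms by (intro measure_Un_le) (auto simp: exp_small_def)
    also have "\<dots> \<le> A * exp (- c * real n) + B * exp (- d * real n)"
      using A(3)[of n] B(3)[of n] by linarith
    also have "\<dots> \<le> A * exp (- min c d * real n) + B * exp (- min c d * real n)"
      using A B by (intro add_mono mult_left_mono) (auto intro!: mult_right_mono)
    also have "\<dots> = (A + B) * 1 * exp (- min c d * real n)"
      by (simp add: algebra_simps)
    also have "\<dots> \<le> (A + B) * real n * exp (- min c d * real n)"
      using A B n by (intro mult_right_mono mult_left_mono) auto
    finally show "prob (E n \<union> F n) \<le> (A + B) * real n * exp (- min c d * real n)" .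
  qed (use A B assms in \<open>auto simp: exp_small_def\<close>)
qed

lemma exp_small_UN:
  assumes "finite I" "\<And>i. i \<in> I \<Longrightarrow> exp_small (E i)"
  shows "exp_small (\<lambda>n. \<Union>i\<in>I. E i n)"
  using assms by (induction I) (auto intro: exp_small_empty exp_small_Un)

lemma exp_small_mono:
  assumes "exp_small F" "\<And>n. E n \<in> events" "\<And>n. N \<le> n \<Longrightarrow> E n \<subseteq> F n"
  shows "exp_small E"
proof -
  obtain A c where A: "0 < c" "0 \<le> A" "\<And>n. prob (F n) \<le> A * exp (- c * real n)"
    using exp_smallE[OF assms(1)] by metis
  show ?thesis
  proof (rule exp_smallI[of _ c A "max N 1"])
    fix n assume n: "max N 1 \<le> n"
    have "prob (E n) \<le> prob (F n)"
      using assms n by (intro finite_measure_mono) (auto simp: exp_small_def)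
    also have "\<dots> \<le> A * 1 * exp (- c * real n)" using A(3)[of n] by simp
    also have "\<dots> \<le> A * real n * exp (- c * real n)"
      using A n by (intro mult_right_mono mult_left_mono) auto
    finally show "prob (E n) \<le> A * real n * exp (- c * real n)" .
  qed (use A assms in auto)
qed

text \<open>Eventually the bound falls below 1, so the event cannot fill the space. Deterministic
  inequalities about the MMD are later read off at such a point.\<close>

lemma exp_small_avoid:
  assumes "exp_small E"
  obtains n \<omega> where "N \<le> n" "\<omega> \<in> space M" "\<omega> \<notin> E n"
proof -
  obtain A c where A: "0 < c" "0 \<le> A" "\<And>n. prob (E n) \<le> A * exp (- c * real n)"
    using exp_smallE[OF assms] by metis
  have "(\<lambda>n. A * exp (- c * real n)) \<longlonglongrightarrow> 0"
    using A(1) by real_asymp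
  then have "eventually (\<lambda>n. A * exp (- c * real n) < 1) sequentially"
    by (rule order_tendstoD) simp
  then have "eventually (\<lambda>n. N \<le> n \<and> A * exp (- c * real n) < 1) sequentially"
    using eventually_ge_at_top by (rule eventually_conj[rotated])
  then obtain n where n: "N \<le> n" "A * exp (- c * real n) < 1"
    using eventually_happens' sequentially_bot by blast
  then have "prob (E n) < 1" using A(3)[of n] by linarith
  then have "\<not> space M \<subseteq> E n"
    using finite_measure_mono[of "space M" "E n"] exp_small_events[OF assms, of n] prob_space by auto
  then show ?thesis using that n by auto
qed

end

section \<open>Concentration of the MMD estimate\<close>

locale kernel_samples = prob_space \<Omega> for \<Omega> :: "'w measure" +
  fixes S :: "'x measure" and X :: "nat \<Rightarrow> nat \<Rightarrow> 'w \<Rightarrow> 'x" and p :: "nat \<Rightarrow> 'x measure"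
    and k :: "'x \<Rightarrow> 'x \<Rightarrow> real" and G :: real and M :: nat
  assumes space_S: "space S = UNIV"
    and prob_p: "i < M \<Longrightarrow> prob_space (p i)"
    and sets_p: "i < M \<Longrightarrow> sets (p i) = sets S"
    and meas_X: "i < M \<Longrightarrow> 1 \<le> l \<Longrightarrow> X i l \<in> measurable \<Omega> S"
    and distr_X: "i < M \<Longrightarrow> 1 \<le> l \<Longrightarrow> distr \<Omega> S (X i l) = p i"
    and indep_X: "indep_vars (\<lambda>_. S) (\<lambda>(i,l). X i l) ({..<M} \<times> {1..})"
    and pd: "pd_kernel k"
    and meas_k: "(\<lambda>(x,y). k x y) \<in> borel_measurable (S \<Otimes>\<^sub>M S)"
    and k_bounds: "0 \<le> k x y" "k x y \<le> G"
    and G_pos: "0 < G"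
begin

text \<open>The mean embedding of \<open>p j\<close>. Accordingly \<open>theta\<close> is the inner
  product of two mean embeddings, and \<open>Vstat\<close> its plug-in estimate, which for
  \<open>i = j\<close> includes the diagonal.\<close>

definition potential :: "nat \<Rightarrow> 'x \<Rightarrow> real" where
  "potential j x = (\<integral>y. k x y \<partial>p j)"

definition theta :: "nat \<Rightarrow> nat \<Rightarrow> real" where
  "theta i j = (\<integral>x. potential j x \<partial>p i)"

definition Vstat :: "nat \<Rightarrow> nat \<Rightarrow> nat \<Rightarrow> 'w \<Rightarrow> real" where
  "Vstat i j n \<omega> = (\<Sum>l=1..n. \<Sum>m=1..n. k (X i l \<omega>) (X j m \<omega>)) / (real n)\<^sup>2"

lemma k_sym: "k x y = k y x"
  using pd by (simp add: pd_kernel_def)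

lemma k_measurable:
  assumes "f \<in> measurable N S" "g \<in> measurable N S"
  shows "(\<lambda>x. k (f x) (g x)) \<in> borel_measurable N"
  using measurable_compose[OF measurable_Pair[OF assms] meas_k] by simp

lemma kX_measurable:
  assumes "i < M" "j < M" "1 \<le> l" "1 \<le> m"
  shows "(\<lambda>\<omega>. k (X i l \<omega>) (X j m \<omega>)) \<in> borel_measurable \<Omega>"
  using assms by (intro k_measurable meas_X)

lemma Vstat_measurable: "i < M \<Longrightarrow> j < M \<Longrightarrow> Vstat i j n \<in> borel_measurable \<Omega>"
  unfolding Vstat_def by (intro borel_measurable_divide borel_measurable_sum kX_measurable) auto

lemma integrable_bounded:
  fixes f :: "'x \<Rightarrow> real"
  assumes "i < M" "f \<in> borel_measurable S" "\<And>x. \<bar>f x\<bar> \<le> b"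
  shows "integrable (p i) f"
proof -
  interpret P: prob_space "p i" by (rule prob_p) fact
  show ?thesis
    by (rule P.integrable_const_bound[of _ b])
      (use assms measurable_cong_sets[OF sets_p refl] in auto)
qed

lemma potential_measurable:
  assumes "j < M"
  shows "potential j \<in> borel_measurable S"
proof -
  interpret P: prob_space "p j" by (rule prob_p) fact
  have "sets (S \<Otimes>\<^sub>M p j) = sets (S \<Otimes>\<^sub>M S)"
    by (intro sets_pair_measure_cong sets_p assms refl)
  then have "(\<lambda>(x,y). k x y) \<in> borel_measurable (S \<Otimes>\<^sub>M p j)"
    using meas_k by (simp cong: measurable_cong_sets)
  then show ?thesis
    unfolding potential_def[abs_def] by (rule P.borel_measurable_lebesgue_integral)
qed

lemma potential_abs_le:
  assumes "j < M"
  shows "\<bar>potential j x\<bar> \<le> G"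
proof -
  interpret P: prob_space "p j" by (rule prob_p) fact
  have "(\<lambda>y. k x y) \<in> borel_measurable S"
    by (rule k_measurable) (auto simp: space_S)
  then have int: "integrable (p j) (\<lambda>y. k x y)"
    using k_bounds by (intro integrable_bounded[OF assms, of _ G]) auto
  have "potential j x \<le> (\<integral>y. G \<partial>p j)"
    unfolding potential_def using k_bounds by (intro Bochner_Integration.integral_mono int) auto
  moreover have "0 \<le> potential j x"
    unfolding potential_def using k_bounds by (intro Bochner_Integration.integral_nonneg) auto
  ultimately show ?thesis by (simp add: P.prob_space)
qed

lemma expectation_X:
  fixes f :: "'x \<Rightarrow> real"
  assumes "i < M" "1 \<le> l" "f \<in> borel_measurable S"
  shows "expectation (\<lambda>\<omega>. f (X i l \<omega>)) = (\<integral>x. f x \<partial>p i)"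
  using integral_distr[OF meas_X[OF assms(1,2)] assms(3)] distr_X[OF assms(1,2)] by simp

text \<open>Two distinct samples are independent, so their joint law is the product measure and
  Fubini yields the iterated integral. The premise \<open>ne\<close> separates samples and not
  sequences, so two samples of one sequence are covered.\<close>

lemma expectation_kX:
  assumes ij: "i < M" "j < M" "1 \<le> l" "1 \<le> m" and ne: "(i, l) \<noteq> (j, m)"
  shows "expectation (\<lambda>\<omega>. k (X i l \<omega>) (X j m \<omega>)) = theta i j"
proof -
  let ?XX = "\<lambda>(i,l). X i l"
  have "indep_var (PiM {(i,l)} (\<lambda>_. S)) (\<lambda>\<omega>. restrict (\<lambda>a. ?XX a \<omega>) {(i,l)})
      (PiM {(j,m)} (\<lambda>_. S)) (\<lambda>\<omega>. restrict (\<lambda>a. ?XX a \<omega>) {(j,m)})"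
    by (rule indep_var_restrict[OF indep_X]) (use ij ne in auto)
  then have "indep_var S ((\<lambda>f. f (i,l)) \<circ> (\<lambda>\<omega>. restrict (\<lambda>a. ?XX a \<omega>) {(i,l)}))
      S ((\<lambda>f. f (j,m)) \<circ> (\<lambda>\<omega>. restrict (\<lambda>a. ?XX a \<omega>) {(j,m)}))"
    by (rule indep_var_compose) (auto intro: measurable_component_singleton)
  then have "indep_var S (X i l) S (X j m)" by (simp add: comp_def)
  then have pair: "p i \<Otimes>\<^sub>M p j = distr \<Omega> (S \<Otimes>\<^sub>M S) (\<lambda>\<omega>. (X i l \<omega>, X j m \<omega>))"
    using indep_var_distribution_eq[of S "X i l" S "X j m"] ij by (simp add: distr_X)
  interpret Pi: prob_space "p i" by (rule prob_p) fact
  interpret Pj: prob_space "p j" by (rule prob_p) fact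
  interpret P: pair_prob_space "p i" "p j" ..
  have "sets (p i \<Otimes>\<^sub>M p j) = sets (S \<Otimes>\<^sub>M S)"
    by (intro sets_pair_measure_cong sets_p ij)
  then have meas: "(\<lambda>(x,y). k x y) \<in> borel_measurable (p i \<Otimes>\<^sub>M p j)"
    using meas_k by (simp cong: measurable_cong_sets)
  have int: "integrable (p i \<Otimes>\<^sub>M p j) (\<lambda>(x,y). k x y)"
    by (rule P.integrable_const_bound[of _ G]) (use meas k_bounds in auto)
  have "expectation (\<lambda>\<omega>. k (X i l \<omega>) (X j m \<omega>))
      = (\<integral>z. (\<lambda>(x,y). k x y) z \<partial>distr \<Omega> (S \<Otimes>\<^sub>M S) (\<lambda>\<omega>. (X i l \<omega>, X j m \<omega>)))"
    by (subst integral_distr) (use meas_k meas_X ij in \<open>auto intro: measurable_Pair\<close>)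
  also have "\<dots> = (\<integral>z. (\<lambda>(x,y). k x y) z \<partial>(p i \<Otimes>\<^sub>M p j))" by (simp add: pair)
  also have "\<dots> = theta i j"
    unfolding theta_def potential_def
    using P.integral_fst'[OF int] by simp
  finally show ?thesis .
qed

text \<open>Disjoint index pairs carry independent samples, so the summands along a matching are
  independent with common mean \<open>theta i j\<close>, and Hoeffding's inequality applies.\<close>

lemma matching_tail:
  assumes ij: "i < M" "j < M" and T: "finite T" "card T \<le> n" "T \<subseteq> {1..}" "\<sigma> ` T \<subseteq> {1..}"
    and ne: "\<And>l. l \<in> T \<Longrightarrow> (i, l) \<noteq> (j, \<sigma> l)"
    and disj: "disjoint_family_on (\<lambda>l. {(i, l), (j, \<sigma> l)}) T"
    and pos: "0 < n" "0 < \<epsilon>"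
  shows "prob {\<omega>\<in>space \<Omega>. real n * \<epsilon> \<le> \<bar>\<Sum>l\<in>T. (k (X i l \<omega>) (X j (\<sigma> l) \<omega>) - theta i j)\<bar>}
    \<le> 2 * exp (- 2 * real n * \<epsilon>\<^sup>2 / G\<^sup>2)"
proof -
  let ?B = "\<lambda>l. {(i, l), (j, \<sigma> l)}"
  have "indep_vars (\<lambda>l. PiM (?B l) (\<lambda>_. S)) (\<lambda>l \<omega>. restrict (\<lambda>a. (\<lambda>(i,l). X i l) a \<omega>) (?B l)) T"
    by (rule indep_vars_restrict[OF indep_X _ disj]) (use ij T in auto)
  then have "indep_vars (\<lambda>_. borel)
      (\<lambda>l \<omega>. (\<lambda>f. k (f (i, l)) (f (j, \<sigma> l))) (restrict (\<lambda>a. (\<lambda>(i,l). X i l) a \<omega>) (?B l))) T"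
    by (rule indep_vars_compose2) (auto intro!: k_measurable measurable_component_singleton)
  then have ind: "indep_vars (\<lambda>_. borel) (\<lambda>l \<omega>. k (X i l \<omega>) (X j (\<sigma> l) \<omega>)) T" by simp
  have "expectation (\<lambda>\<omega>. k (X i l \<omega>) (X j (\<sigma> l) \<omega>)) = theta i j" if "l \<in> T" for l
    using that ij T ne by (intro expectation_kX) auto
  from Hoeffding_uniform[OF T(1,2) ind _ this pos, where a = 0 and b = G]
  show ?thesis using k_bounds G_pos by simp
qed

lemma mean_exp_small:
  fixes f :: "'x \<Rightarrow> real"
  assumes i: "i < M" and f: "f \<in> borel_measurable S" "\<And>x. \<bar>f x\<bar> \<le> b" and \<epsilon>: "0 < \<epsilon>"
  shows "exp_small (\<lambda>n. {\<omega>\<in>space \<Omega>. \<epsilon> \<le> \<bar>(\<Sum>l=1..n. f (X i l \<omega>)) / real n - (\<integral>x. f x \<partial>p i)\<bar>})"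
proof -
  \<comment> \<open>The enlarged bound \<open>?b\<close> guarantees an interval of positive
    length.\<close>
  let ?m = "\<integral>x. f x \<partial>p i" and ?b = "\<bar>b\<bar> + 1"
  have meas: "(\<lambda>\<omega>. f (X i l \<omega>)) \<in> borel_measurable \<Omega>" if "l \<in> {1..n}" for l n
    using measurable_compose[OF meas_X[OF i] f(1)] that by auto
  have "indep_vars (\<lambda>_. borel) (\<lambda>a \<omega>. f ((\<lambda>(i,l). X i l) a \<omega>)) ({..<M} \<times> {1..})"
    by (rule indep_vars_compose2[OF indep_X]) (use f in auto)
  then have ind: "indep_vars (\<lambda>_. borel) (\<lambda>a \<omega>. f ((\<lambda>(i,l). X i l) a \<omega>)) ({i} \<times> {1..n})" for n
    by (rule indep_vars_subset) (use i in auto)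
  show ?thesis
  proof (rule exp_smallI[of _ "2 * \<epsilon>\<^sup>2 / (?b - - ?b)\<^sup>2" 2 1])
    fix n :: nat assume n: "1 \<le> n"
    have eq: "(\<Sum>a\<in>{i} \<times> {1..n}. (f ((\<lambda>(i,l). X i l) a \<omega>) - ?m)) = (\<Sum>l=1..n. f (X i l \<omega>)) - real n * ?m" for \<omega>
    proof -
      have "(\<Sum>a\<in>{i} \<times> {1..n}. (f ((\<lambda>(i,l). X i l) a \<omega>) - ?m)) = (\<Sum>l=1..n. (f (X i l \<omega>) - ?m))"
        by (rule sum.reindex_bij_witness[where i = "Pair i" and j = snd]) auto
      then show ?thesis by (simp add: sum_subtractf)
    qed
    have "prob {\<omega>\<in>space \<Omega>. real n * \<epsilon> \<le> \<bar>\<Sum>a\<in>{i} \<times> {1..n}. (f ((\<lambda>(i,l). X i l) a \<omega>) - ?m)\<bar>}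
        \<le> 2 * exp (- 2 * real n * \<epsilon>\<^sup>2 / (?b - - ?b)\<^sup>2)"
    proof (rule Hoeffding_uniform[OF _ _ ind])
      show "f ((\<lambda>(i,l). X i l) t \<omega>) \<in> {- ?b..?b}" for t \<omega>
        using f(2)[of "(\<lambda>(i,l). X i l) t \<omega>"] by auto
      show "expectation (\<lambda>\<omega>. f ((\<lambda>(i,l). X i l) t \<omega>)) = ?m" if "t \<in> {i} \<times> {1..n}" for t
        using that i f by (auto intro!: expectation_X)
    qed (use n \<epsilon> in auto)
    moreover have "\<epsilon> \<le> \<bar>(\<Sum>l=1..n. f (X i l \<omega>)) / real n - ?m\<bar> \<longleftrightarrow>
        real n * \<epsilon> \<le> \<bar>(\<Sum>l=1..n. f (X i l \<omega>)) - real n * ?m\<bar>" for \<omega>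
    proof -
      have "(\<Sum>l=1..n. f (X i l \<omega>)) - real n * ?m = real n * ((\<Sum>l=1..n. f (X i l \<omega>)) / real n - ?m)"
        using n by (simp add: field_simps)
      then show ?thesis using n by (simp only: abs_mult) simp
    qed
    ultimately have "prob {\<omega>\<in>space \<Omega>. \<epsilon> \<le> \<bar>(\<Sum>l=1..n. f (X i l \<omega>)) / real n - ?m\<bar>}
        \<le> 2 * 1 * exp (- (2 * \<epsilon>\<^sup>2 / (?b - - ?b)\<^sup>2) * real n)"
      unfolding eq by (simp add: mult_ac)
    also have "\<dots> \<le> 2 * real n * exp (- (2 * \<epsilon>\<^sup>2 / (?b - - ?b)\<^sup>2) * real n)"
      using n by (intro mult_right_mono mult_left_mono) auto
    finally show "prob {\<omega>\<in>space \<Omega>. \<epsilon> \<le> \<bar>(\<Sum>l=1..n. f (X i l \<omega>)) / real n - ?m\<bar>}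
        \<le> 2 * real n * exp (- (2 * \<epsilon>\<^sup>2 / (?b - - ?b)\<^sup>2) * real n)" .
  next
    show "{\<omega>\<in>space \<Omega>. \<epsilon> \<le> \<bar>(\<Sum>l=1..n. f (X i l \<omega>)) / real n - ?m\<bar>} \<in> events" for n
      using meas by measurable
    show "0 < 2 * \<epsilon>\<^sup>2 / (?b - - ?b)\<^sup>2" using \<epsilon> by (intro divide_pos_pos) auto
  qed auto
qed

text \<open>If each of the \<open>n\<close> antidiagonal sums deviates by less than
  \<open>n * \<epsilon>\<close>, their average deviates by less than \<epsilon>. The union bound
  over the antidiagonals costs the factor \<open>n\<close> that \<open>exp_smallI\<close>
  tolerates.\<close>

lemma Vstat_cross_exp_small:
  assumes ij: "i < M" "j < M" "i \<noteq> j" and \<epsilon>: "0 < \<epsilon>"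
  shows "exp_small (\<lambda>n. {\<omega>\<in>space \<Omega>. \<epsilon> \<le> \<bar>Vstat i j n \<omega> - theta i j\<bar>})"
proof (rule exp_smallI[of _ "2 * \<epsilon>\<^sup>2 / G\<^sup>2" 2 1])
  fix n :: nat assume n: "1 \<le> n"
  let ?D = "\<lambda>l m \<omega>. k (X i l \<omega>) (X j m \<omega>) - theta i j"
  let ?E = "\<lambda>c. {\<omega>\<in>space \<Omega>. real n * \<epsilon> \<le> \<bar>\<Sum>l=1..n. ?D l (antidiag n c l) \<omega>\<bar>}"
  have E: "?E c \<in> events" if "c < n" for c
  proof -
    have "(\<lambda>\<omega>. ?D l (antidiag n c l) \<omega>) \<in> borel_measurable \<Omega>" if "l \<in> {1..n}" for l
      using ij that antidiag_range[OF \<open>c < n\<close> that] by (intro borel_measurable_diff kX_measurable) auto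
    then show ?thesis by measurable
  qed
  have "{\<omega>\<in>space \<Omega>. \<epsilon> \<le> \<bar>Vstat i j n \<omega> - theta i j\<bar>} \<subseteq> (\<Union>c<n. ?E c)"
  proof (rule subsetI, rule ccontr)
    fix \<omega> assume \<omega>: "\<omega> \<in> {\<omega>\<in>space \<Omega>. \<epsilon> \<le> \<bar>Vstat i j n \<omega> - theta i j\<bar>}" "\<omega> \<notin> (\<Union>c<n. ?E c)"
    have "(real n)\<^sup>2 * (Vstat i j n \<omega> - theta i j) = (\<Sum>l=1..n. \<Sum>m=1..n. ?D l m \<omega>)"
      using n by (simp add: Vstat_def sum_subtractf power2_eq_square field_simps)
    also have "\<dots> = (\<Sum>c<n. \<Sum>l=1..n. ?D l (antidiag n c l) \<omega>)" by (rule sum_antidiag)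
    finally have "(real n)\<^sup>2 * \<bar>Vstat i j n \<omega> - theta i j\<bar> = \<bar>\<Sum>c<n. \<Sum>l=1..n. ?D l (antidiag n c l) \<omega>\<bar>"
      by (metis abs_mult abs_power2)
    also have "\<dots> \<le> (\<Sum>c<n. \<bar>\<Sum>l=1..n. ?D l (antidiag n c l) \<omega>\<bar>)" by (rule sum_abs)
    also have "\<dots> < (\<Sum>c<n. real n * \<epsilon>)"
      by (rule sum_strict_mono) (use n \<omega> in \<open>auto simp: not_le lessThan_empty_iff\<close>)
    also have "\<dots> = (real n)\<^sup>2 * \<epsilon>" by (simp add: power2_eq_square)
    finally show False using \<omega> n by simp
  qed
  then have "prob {\<omega>\<in>space \<Omega>. \<epsilon> \<le> \<bar>Vstat i j n \<omega> - theta i j\<bar>} \<le> prob (\<Union>c<n. ?E c)"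
    using E by (intro finite_measure_mono) auto
  also have "\<dots> \<le> (\<Sum>c<n. prob (?E c))"
    using E by (intro finite_measure_subadditive_finite) auto
  also have "\<dots> \<le> (\<Sum>c<n. 2 * exp (- 2 * real n * \<epsilon>\<^sup>2 / G\<^sup>2))"
  proof (rule sum_mono)
    fix c assume "c \<in> {..<n}"
    then have c: "c < n" by simp
    show "prob (?E c) \<le> 2 * exp (- 2 * real n * \<epsilon>\<^sup>2 / G\<^sup>2)"
    proof (rule matching_tail)
      show "antidiag n c ` {1..n} \<subseteq> {1..}" using antidiag_range[OF c] by auto
      show "disjoint_family_on (\<lambda>l. {(i, l), (j, antidiag n c l)}) {1..n}"
        unfolding disjoint_family_on_def
      proof (intro ballI impI)
        fix l m assume lm: "l \<in> {1..n}" "m \<in> {1..n}" "l \<noteq> m"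
        \<comment> \<open>An involution is injective; since \<open>i \<noteq> j\<close>, no further
          coincidence between the pairs is possible.\<close>
        then have "antidiag n c l \<noteq> antidiag n c m"
          by (metis antidiag_invol[OF c])
        then show "{(i, l), (j, antidiag n c l)} \<inter> {(i, m), (j, antidiag n c m)} = {}"
          using lm ij by auto
      qed
    qed (use n ij \<epsilon> in auto)
  qed
  finally show "prob {\<omega>\<in>space \<Omega>. \<epsilon> \<le> \<bar>Vstat i j n \<omega> - theta i j\<bar>}
      \<le> 2 * real n * exp (- (2 * \<epsilon>\<^sup>2 / G\<^sup>2) * real n)"
    by (simp add: mult_ac)
next
  show "{\<omega>\<in>space \<Omega>. \<epsilon> \<le> \<bar>Vstat i j n \<omega> - theta i j\<bar>} \<in> events" for n
    using Vstat_measurable[OF ij(1,2)] by measurable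
qed (use \<epsilon> G_pos in auto)

lemma Vstat_same_exp_small:
  assumes i: "i < M" and \<epsilon>: "0 < \<epsilon>"
  shows "exp_small (\<lambda>n. {\<omega>\<in>space \<Omega>. \<epsilon> \<le> \<bar>Vstat i i n \<omega> - theta i i\<bar>})"
proof (rule exp_smallI[of _ "2 * (\<epsilon> / 4)\<^sup>2 / G\<^sup>2" 2 "nat \<lceil>2 * G / \<epsilon>\<rceil> + 1"])
  fix n :: nat assume "nat \<lceil>2 * G / \<epsilon>\<rceil> + 1 \<le> n"
  \<comment> \<open>The second bound makes the diagonal contribution at most half of
    \<open>(real n)\<^sup>2 * \<epsilon>\<close>. The antidiagonals share the other half, and since
    each half sum is counted twice, its threshold is \<epsilon> / 4.\<close>
  then have n: "1 \<le> n" "2 * G / \<epsilon> \<le> real n" by linarith+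
  \<comment> \<open>The diagonal contributes at most \<open>n G\<close>; off the diagonal the involution makes every term of
    an antidiagonal occur twice, so it suffices to control the half \<open>l < antidiag n c l\<close>.\<close>
  let ?D = "\<lambda>l m \<omega>. if l = m then 0 else k (X i l \<omega>) (X i m \<omega>) - theta i i"
  let ?T = "\<lambda>c. {l\<in>{1..n}. l < antidiag n c l}"
  let ?E = "\<lambda>c. {\<omega>\<in>space \<Omega>. real n * (\<epsilon> / 4) \<le>
    \<bar>\<Sum>l\<in>?T c. (k (X i l \<omega>) (X i (antidiag n c l) \<omega>) - theta i i)\<bar>}"
  have theta: "\<bar>k x y - theta i i\<bar> \<le> G" for x y
  proof -
    have "theta i i = expectation (\<lambda>\<omega>. k (X i 1 \<omega>) (X i 2 \<omega>))"
      using i by (intro expectation_kX[symmetric]) auto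
    moreover have "integrable \<Omega> (\<lambda>\<omega>. k (X i 1 \<omega>) (X i 2 \<omega>))"
      by (rule integrable_const_bound[of _ G]) (use i k_bounds kX_measurable in auto)
    then have "expectation (\<lambda>\<omega>. k (X i 1 \<omega>) (X i 2 \<omega>)) \<le> (\<integral>\<omega>. G \<partial>\<Omega>)"
      using k_bounds by (intro Bochner_Integration.integral_mono) auto
    moreover have "0 \<le> expectation (\<lambda>\<omega>. k (X i 1 \<omega>) (X i 2 \<omega>))"
      using k_bounds by (intro Bochner_Integration.integral_nonneg) auto
    ultimately have "0 \<le> theta i i" "theta i i \<le> G" by (simp_all add: prob_space)
    then show ?thesis using k_bounds[of x y] by auto
  qed
  have E: "?E c \<in> events" if "c < n" for c
  proof -
    have "(\<lambda>\<omega>. k (X i l \<omega>) (X i (antidiag n c l) \<omega>) - theta i i) \<in> borel_measurable \<Omega>" if "l \<in> ?T c" for l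
      using i that antidiag_range[OF \<open>c < n\<close>, of l]
      by (intro borel_measurable_diff kX_measurable) auto
    then show ?thesis by measurable
  qed
  have "{\<omega>\<in>space \<Omega>. \<epsilon> \<le> \<bar>Vstat i i n \<omega> - theta i i\<bar>} \<subseteq> (\<Union>c<n. ?E c)"
  proof (rule subsetI, rule ccontr)
    fix \<omega> assume \<omega>: "\<omega> \<in> {\<omega>\<in>space \<Omega>. \<epsilon> \<le> \<bar>Vstat i i n \<omega> - theta i i\<bar>}" "\<omega> \<notin> (\<Union>c<n. ?E c)"
    let ?d = "\<Sum>l=1..n. (k (X i l \<omega>) (X i l \<omega>) - theta i i)"
    have "(real n)\<^sup>2 * (Vstat i i n \<omega> - theta i i) =
        (\<Sum>l=1..n. \<Sum>m=1..n. k (X i l \<omega>) (X i m \<omega>) - theta i i)"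
      using n by (simp add: Vstat_def sum_subtractf power2_eq_square field_simps)
    also have "\<dots> = (\<Sum>l=1..n. \<Sum>m=1..n. ?D l m \<omega> +
        (if l = m then k (X i l \<omega>) (X i l \<omega>) - theta i i else 0))"
      by (intro sum.cong refl) auto
    also have "\<dots> = (\<Sum>l=1..n. \<Sum>m=1..n. ?D l m \<omega>) + ?d"
      by (simp only: sum.distrib) (simp add: sum.delta')
    also have "(\<Sum>l=1..n. \<Sum>m=1..n. ?D l m \<omega>) = (\<Sum>c<n. \<Sum>l=1..n. ?D l (antidiag n c l) \<omega>)"
      by (rule sum_antidiag)
    also have "\<dots> = (\<Sum>c<n. 2 * (\<Sum>l\<in>?T c. ?D l (antidiag n c l) \<omega>))"
    proof (rule sum.cong[OF refl])
      fix c assume "c \<in> {..<n}"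
      then have "c < n" by simp
      show "(\<Sum>l=1..n. ?D l (antidiag n c l) \<omega>) = 2 * (\<Sum>l\<in>?T c. ?D l (antidiag n c l) \<omega>)"
        by (rule sum_involution_symmetric[OF antidiag_range[OF \<open>c < n\<close>] antidiag_invol[OF \<open>c < n\<close>]])
          (auto simp: k_sym)
    qed
    finally have "(real n)\<^sup>2 * \<bar>Vstat i i n \<omega> - theta i i\<bar> =
        \<bar>(\<Sum>c<n. 2 * (\<Sum>l\<in>?T c. ?D l (antidiag n c l) \<omega>)) + ?d\<bar>"
      by (metis abs_mult abs_power2)
    also have "\<dots> \<le> (\<Sum>c<n. \<bar>2 * (\<Sum>l\<in>?T c. ?D l (antidiag n c l) \<omega>)\<bar>) + real n * G"
    proof -
      have "\<bar>?d\<bar> \<le> (\<Sum>l=1..n. G)"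
        by (rule order_trans[OF sum_abs]) (intro sum_mono theta)
      then have "\<bar>?d\<bar> \<le> real n * G" by simp
      moreover have "\<bar>\<Sum>c<n. 2 * (\<Sum>l\<in>?T c. ?D l (antidiag n c l) \<omega>)\<bar>
          \<le> (\<Sum>c<n. \<bar>2 * (\<Sum>l\<in>?T c. ?D l (antidiag n c l) \<omega>)\<bar>)" by (rule sum_abs)
      ultimately show ?thesis by linarith
    qed
    also have "(\<Sum>c<n. \<bar>2 * (\<Sum>l\<in>?T c. ?D l (antidiag n c l) \<omega>)\<bar>) < (\<Sum>c<n. real n * (\<epsilon> / 2))"
    proof (rule sum_strict_mono)
      fix c assume c: "c \<in> {..<n}"
      have "(\<Sum>l\<in>?T c. ?D l (antidiag n c l) \<omega>) =
          (\<Sum>l\<in>?T c. (k (X i l \<omega>) (X i (antidiag n c l) \<omega>) - theta i i))"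
        by (intro sum.cong refl) auto
      moreover have "\<bar>\<Sum>l\<in>?T c. (k (X i l \<omega>) (X i (antidiag n c l) \<omega>) - theta i i)\<bar> < real n * (\<epsilon> / 4)"
        using \<omega> c by (auto simp: not_le)
      ultimately show "\<bar>2 * (\<Sum>l\<in>?T c. ?D l (antidiag n c l) \<omega>)\<bar> < real n * (\<epsilon> / 2)"
        by (simp add: abs_mult)
    qed (use n in \<open>auto simp: lessThan_empty_iff\<close>)
    also have "(\<Sum>c<n. real n * (\<epsilon> / 2)) + real n * G \<le> (real n)\<^sup>2 * \<epsilon>"
    proof -
      have "real n * (2 * G) \<le> real n * (real n * \<epsilon>)"
        using n \<epsilon> by (intro mult_left_mono) (auto simp: field_simps)
      then show ?thesis by (simp add: power2_eq_square field_simps)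
    qed
    finally show False using \<omega> n by simp
  qed
  then have "prob {\<omega>\<in>space \<Omega>. \<epsilon> \<le> \<bar>Vstat i i n \<omega> - theta i i\<bar>} \<le> prob (\<Union>c<n. ?E c)"
    using E by (intro finite_measure_mono) auto
  also have "\<dots> \<le> (\<Sum>c<n. prob (?E c))"
    using E by (intro finite_measure_subadditive_finite) auto
  also have "\<dots> \<le> (\<Sum>c<n. 2 * exp (- 2 * real n * (\<epsilon> / 4)\<^sup>2 / G\<^sup>2))"
  proof (rule sum_mono)
    fix c assume "c \<in> {..<n}"
    then have c: "c < n" by simp
    show "prob (?E c) \<le> 2 * exp (- 2 * real n * (\<epsilon> / 4)\<^sup>2 / G\<^sup>2)"
    proof (rule matching_tail)
      show "antidiag n c ` ?T c \<subseteq> {1..}" using antidiag_range[OF c] by auto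
      show "card (?T c) \<le> n" using card_mono[of "{1..n}" "?T c"] by (simp add: subset_iff)
      show "disjoint_family_on (\<lambda>l. {(i, l), (i, antidiag n c l)}) (?T c)"
        unfolding disjoint_family_on_def
      proof (intro ballI impI)
        fix l m assume lm: "l \<in> ?T c" "m \<in> ?T c" "l \<noteq> m"
        \<comment> \<open>Within one sequence, \<open>l\<close> might equal
          \<open>antidiag n c m\<close>. Then \<open>m\<close> would equal
          \<open>antidiag n c l\<close>, and the conditions defining \<open>?T c\<close> would give
          both \<open>l < m\<close> and \<open>m < l\<close>.\<close>
        have "antidiag n c (antidiag n c l) = l" "antidiag n c (antidiag n c m) = m"
          using lm by (auto intro!: antidiag_invol[OF c])
        then show "{(i, l), (i, antidiag n c l)} \<inter> {(i, m), (i, antidiag n c m)} = {}"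
          using lm by auto
      qed
    qed (use n i \<epsilon> in auto)
  qed
  finally show "prob {\<omega>\<in>space \<Omega>. \<epsilon> \<le> \<bar>Vstat i i n \<omega> - theta i i\<bar>}
      \<le> 2 * real n * exp (- (2 * (\<epsilon> / 4)\<^sup>2 / G\<^sup>2) * real n)"
    by (simp add: mult_ac)
next
  show "{\<omega>\<in>space \<Omega>. \<epsilon> \<le> \<bar>Vstat i i n \<omega> - theta i i\<bar>} \<in> events" for n
    using Vstat_measurable[OF i i] by measurable
qed (use \<epsilon> G_pos in auto)

section \<open>From V-statistics to the estimate \<open>dhat\<close>\<close>

text \<open>The squared distance of the two mean embeddings, which is the population value estimated
  by the square of \<open>dhat\<close>.\<close>

definition mmd2 :: "nat \<Rightarrow> nat \<Rightarrow> real" where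
  "mmd2 i j = theta i i + theta j j - 2 * theta i j"

lemma dhat_eq_Vstat:
  "dhat k X \<omega> n i j = sqrt (Vstat i i n \<omega> + Vstat j j n \<omega> - 2 * Vstat i j n \<omega>)"
  by (simp add: dhat_def Vstat_def sum.distrib sum_subtractf sum_distrib_left[symmetric]
      add_divide_distrib diff_divide_distrib)

lemma Vstat_form_nonneg: "0 \<le> Vstat i i n \<omega> + Vstat j j n \<omega> - 2 * Vstat i j n \<omega>"
proof -
  have "0 \<le> dhat k X \<omega> n i j"
    unfolding dhat_eq_knorm2[OF pd] using knorm2_nonneg[OF pd] by simp
  \<comment> \<open>The function \<open>sqrt\<close> is odd on the reals, so a nonnegative root
    forces a nonnegative argument.\<close>
  then show ?thesis by (simp add: dhat_eq_Vstat)
qed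

lemma dhat_measurable:
  assumes "i < M" "j < M"
  shows "(\<lambda>\<omega>. dhat k X \<omega> n i j) \<in> borel_measurable \<Omega>"
proof -
  have [measurable]: "Vstat i i n \<in> borel_measurable \<Omega>" "Vstat j j n \<in> borel_measurable \<Omega>"
    "Vstat i j n \<in> borel_measurable \<Omega>"
    using assms by (auto intro: Vstat_measurable)
  show ?thesis unfolding dhat_eq_Vstat by measurable
qed

lemma dhat_le: "dhat k X \<omega> n i j \<le> sqrt (2 * G)"
proof -
  have "Vstat i' i' n \<omega> \<le> G" for i'
  proof (cases "n = 0")
    case False
    have "(\<Sum>l=1..n. \<Sum>m=1..n. k (X i' l \<omega>) (X i' m \<omega>)) \<le> (\<Sum>l=1..n. \<Sum>m=1..n. G)"
      using k_bounds by (intro sum_mono) auto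
    then show ?thesis using False by (simp add: Vstat_def power2_eq_square field_simps)
  qed (use G_pos in \<open>simp add: Vstat_def\<close>)
  moreover have "0 \<le> Vstat i j n \<omega>"
    unfolding Vstat_def using k_bounds by (intro divide_nonneg_nonneg sum_nonneg) auto
  ultimately show ?thesis
    unfolding dhat_eq_Vstat by (intro real_sqrt_le_mono) (smt (verit))
qed

lemma Vstat_form_exp_small:
  assumes ij: "i < M" "j < M" "i \<noteq> j" and \<epsilon>: "0 < \<epsilon>"
  shows "exp_small (\<lambda>n. {\<omega>\<in>space \<Omega>.
    \<epsilon> \<le> \<bar>Vstat i i n \<omega> + Vstat j j n \<omega> - 2 * Vstat i j n \<omega> - mmd2 i j\<bar>})"
proof (rule exp_small_mono)
  \<comment> \<open>The coefficients 1, 1 and 2 have total weight 4, hence the share \<epsilon> / 4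
    for each V-statistic.\<close>
  show "exp_small (\<lambda>n. {\<omega>\<in>space \<Omega>. \<epsilon> / 4 \<le> \<bar>Vstat i i n \<omega> - theta i i\<bar>} \<union>
      {\<omega>\<in>space \<Omega>. \<epsilon> / 4 \<le> \<bar>Vstat j j n \<omega> - theta j j\<bar>} \<union>
      {\<omega>\<in>space \<Omega>. \<epsilon> / 4 \<le> \<bar>Vstat i j n \<omega> - theta i j\<bar>})"
    using ij \<epsilon> by (intro exp_small_Un Vstat_same_exp_small Vstat_cross_exp_small) auto
  have [measurable]: "Vstat i i n \<in> borel_measurable \<Omega>" "Vstat j j n \<in> borel_measurable \<Omega>"
    "Vstat i j n \<in> borel_measurable \<Omega>" for n
    using ij by (auto intro: Vstat_measurable)
  show "{\<omega>\<in>space \<Omega>. \<epsilon> \<le> \<bar>Vstat i i n \<omega> + Vstat j j n \<omega> - 2 * Vstat i j n \<omega> - mmd2 i j\<bar>} \<in> events" for n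
    by measurable
  have "\<epsilon> / 4 \<le> \<bar>a - a'\<bar> \<or> \<epsilon> / 4 \<le> \<bar>b - b'\<bar> \<or> \<epsilon> / 4 \<le> \<bar>c - c'\<bar>"
    if "\<epsilon> \<le> \<bar>a + b - 2 * c - (a' + b' - 2 * c')\<bar>" for a b c a' b' c' :: real
    using that by linarith
  then show "{\<omega>\<in>space \<Omega>. \<epsilon> \<le> \<bar>Vstat i i n \<omega> + Vstat j j n \<omega> - 2 * Vstat i j n \<omega> - mmd2 i j\<bar>}
      \<subseteq> {\<omega>\<in>space \<Omega>. \<epsilon> / 4 \<le> \<bar>Vstat i i n \<omega> - theta i i\<bar>} \<union>
      {\<omega>\<in>space \<Omega>. \<epsilon> / 4 \<le> \<bar>Vstat j j n \<omega> - theta j j\<bar>} \<union>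
      {\<omega>\<in>space \<Omega>. \<epsilon> / 4 \<le> \<bar>Vstat i j n \<omega> - theta i j\<bar>}" for n
    unfolding mmd2_def by blast
qed

text \<open>Inherited from the estimates: each of them is a squared norm, and some realisation comes
  within any \<open>e\<close> of \<open>mmd2 i j\<close>.\<close>

lemma mmd2_nonneg:
  assumes ij: "i < M" "j < M" "i \<noteq> j"
  shows "0 \<le> mmd2 i j"
proof (rule field_le_epsilon)
  fix e :: real assume "0 < e"
  then obtain n \<omega> where "\<bar>Vstat i i n \<omega> + Vstat j j n \<omega> - 2 * Vstat i j n \<omega> - mmd2 i j\<bar> < e"
    by (rule exp_small_avoid[OF Vstat_form_exp_small[OF ij]]) (auto simp: not_le)
  then show "0 \<le> mmd2 i j + e"
    using Vstat_form_nonneg[of i n \<omega> j] by linarith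
qed

lemma dhat_exp_small:
  assumes ij: "i < M" "j < M" "i \<noteq> j" and \<epsilon>: "0 < \<epsilon>"
  shows "exp_small (\<lambda>n. {\<omega>\<in>space \<Omega>. \<epsilon> \<le> \<bar>dhat k X \<omega> n i j - sqrt (mmd2 i j)\<bar>})"
proof (rule exp_small_mono)
  show "exp_small (\<lambda>n. {\<omega>\<in>space \<Omega>.
      \<epsilon>\<^sup>2 \<le> \<bar>Vstat i i n \<omega> + Vstat j j n \<omega> - 2 * Vstat i j n \<omega> - mmd2 i j\<bar>})"
    using ij \<epsilon> by (intro Vstat_form_exp_small) auto
  show "{\<omega>\<in>space \<Omega>. \<epsilon> \<le> \<bar>dhat k X \<omega> n i j - sqrt (mmd2 i j)\<bar>} \<in> events" for n
    using dhat_measurable[OF ij(1,2)] by measurable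
  \<comment> \<open>Taking roots turns accuracy \<open>\<epsilon>\<^sup>2\<close> into accuracy
    \<epsilon>, since the square of a difference of roots is at most the difference of the
    arguments.\<close>
  have key: "\<epsilon>\<^sup>2 \<le> \<bar>a - b\<bar>" if "\<epsilon> \<le> \<bar>sqrt a - sqrt b\<bar>" "0 \<le> a" "0 \<le> b" for a b
  proof -
    have "\<epsilon>\<^sup>2 \<le> \<bar>sqrt a - sqrt b\<bar> * \<bar>sqrt a - sqrt b\<bar>"
      using that \<epsilon> unfolding power2_eq_square by (intro mult_mono) auto
    also have "\<dots> \<le> \<bar>sqrt a - sqrt b\<bar> * (sqrt a + sqrt b)"
      using that by (intro mult_left_mono) (auto simp: abs_le_iff)
    also have "\<dots> = \<bar>(sqrt a - sqrt b) * (sqrt a + sqrt b)\<bar>"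
      using that by (simp add: abs_mult)
    also have "(sqrt a - sqrt b) * (sqrt a + sqrt b) = a - b"
      using that by (simp add: algebra_simps)
    finally show ?thesis .
  qed
  show "{\<omega>\<in>space \<Omega>. \<epsilon> \<le> \<bar>dhat k X \<omega> n i j - sqrt (mmd2 i j)\<bar>} \<subseteq> {\<omega>\<in>space \<Omega>.
      \<epsilon>\<^sup>2 \<le> \<bar>Vstat i i n \<omega> + Vstat j j n \<omega> - 2 * Vstat i j n \<omega> - mmd2 i j\<bar>}" for n
    using key[OF _ Vstat_form_nonneg mmd2_nonneg[OF ij]] by (auto simp: dhat_eq_Vstat)
qed

section \<open>Identification of the limit with the MMD\<close>

text \<open>The union of the three exponentially small events misses some point, which gives one
  realisation where all three averages are accurate. Statements about the measures then reduce to
  finite expansions.\<close>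

lemma representative_sample:
  fixes f :: "'x \<Rightarrow> real"
  assumes ij: "i < M" "j < M" "i \<noteq> j" and f: "f \<in> borel_measurable S" "\<And>x. \<bar>f x\<bar> \<le> b"
    and \<epsilon>: "0 < \<epsilon>"
  obtains n \<omega> where "\<bar>dhat k X \<omega> n i j - sqrt (mmd2 i j)\<bar> < \<epsilon>"
    "\<bar>(\<Sum>l=1..n. f (X i l \<omega>)) / real n - (\<integral>x. f x \<partial>p i)\<bar> < \<epsilon>"
    "\<bar>(\<Sum>l=1..n. f (X j l \<omega>)) / real n - (\<integral>x. f x \<partial>p j)\<bar> < \<epsilon>"
proof -
  have "exp_small (\<lambda>n. {\<omega>\<in>space \<Omega>. \<epsilon> \<le> \<bar>dhat k X \<omega> n i j - sqrt (mmd2 i j)\<bar>} \<union>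
      {\<omega>\<in>space \<Omega>. \<epsilon> \<le> \<bar>(\<Sum>l=1..n. f (X i l \<omega>)) / real n - (\<integral>x. f x \<partial>p i)\<bar>} \<union>
      {\<omega>\<in>space \<Omega>. \<epsilon> \<le> \<bar>(\<Sum>l=1..n. f (X j l \<omega>)) / real n - (\<integral>x. f x \<partial>p j)\<bar>})"
    by (intro exp_small_Un dhat_exp_small mean_exp_small[OF _ f] ij \<epsilon>)
  from exp_small_avoid[OF this, of 0] show ?thesis
    using that by (auto simp: not_le)
qed

lemma k_section_measurable: "(\<lambda>y. k x y) \<in> borel_measurable S"
  by (rule k_measurable) (auto simp: space_S)

lemma kfun_measurable: "kfun k ps \<in> borel_measurable S"
proof (induction ps)
  case (Cons q ps)
  obtain c x where "q = (c, x)" by force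
  then have "kfun k (q # ps) = (\<lambda>y. c * k x y + kfun k ps y)" by (auto simp: kfun_def)
  then show ?case using Cons k_section_measurable by simp
qed (simp add: kfun_def[abs_def])

lemma integral_kfun:
  assumes "i < M"
  shows "integrable (p i) (kfun k ps) \<and> (\<integral>y. kfun k ps y \<partial>p i) = (\<Sum>(c,x)\<leftarrow>ps. c * potential i x)"
proof (induction ps)
  case (Cons q ps)
  obtain c x where q: "q = (c, x)" by force
  then have "kfun k (q # ps) = (\<lambda>y. c * k x y + kfun k ps y)" by (auto simp: kfun_def)
  moreover have "integrable (p i) (\<lambda>y. k x y)"
    using k_bounds by (intro integrable_bounded[OF assms k_section_measurable, of _ G]) auto
  ultimately show ?case using Cons q by (simp add: potential_def)
qed (simp add: kfun_def[abs_def])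

lemma rkhs_unit_ball_measurable:
  assumes "f \<in> rkhs_unit_ball k"
  shows "f \<in> borel_measurable S"
proof -
  obtain g where "\<And>y. (\<lambda>n. kfun k (g n) y) \<longlonglongrightarrow> f y"
    using assms by (auto simp: rkhs_unit_ball_def)
  then show ?thesis
    by (rule borel_measurable_LIMSEQ_real[OF _ kfun_measurable])
qed

lemma theta_sym:
  assumes "i < M" "j < M"
  shows "theta i j = theta j i"
proof -
  have "theta i j = expectation (\<lambda>\<omega>. k (X i 1 \<omega>) (X j 2 \<omega>))"
    using assms by (intro expectation_kX[symmetric]) auto
  also have "\<dots> = expectation (\<lambda>\<omega>. k (X j 2 \<omega>) (X i 1 \<omega>))" by (simp add: k_sym)
  also have "\<dots> = theta j i" using assms by (intro expectation_kX) auto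
  finally show ?thesis .
qed

text \<open>On a representative sample the integrals are nearly sample means. The difference of
  these means is the inner product of \<open>f\<close> with \<open>empdiff\<close>, so it is at most
  the norm \<open>dhat\<close>.\<close>

lemma rkhs_integral_diff_le:
  assumes ij: "i < M" "j < M" "i \<noteq> j" and f: "f \<in> rkhs_unit_ball k"
  shows "(\<integral>x. f x \<partial>p i) - (\<integral>x. f x \<partial>p j) \<le> sqrt (mmd2 i j)"
proof (rule field_le_epsilon)
  fix e :: real assume "0 < e"
  have "\<bar>f x\<bar> \<le> sqrt G" for x
    using rkhs_unit_ball_abs_le[OF pd f, of x] k_bounds(2)[of x x] real_sqrt_le_mono order_trans by blast
  then obtain n \<omega> where s: "\<bar>dhat k X \<omega> n i j - sqrt (mmd2 i j)\<bar> < e / 3"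
    "\<bar>(\<Sum>l=1..n. f (X i l \<omega>)) / real n - (\<integral>x. f x \<partial>p i)\<bar> < e / 3"
    "\<bar>(\<Sum>l=1..n. f (X j l \<omega>)) / real n - (\<integral>x. f x \<partial>p j)\<bar> < e / 3"
    by (rule representative_sample[OF ij rkhs_unit_ball_measurable[OF f], of "sqrt G" "e / 3"])
      (use \<open>0 < e\<close> in auto)
  have "\<bar>(\<Sum>l=1..n. f (X i l \<omega>)) / real n - (\<Sum>l=1..n. f (X j l \<omega>)) / real n\<bar> \<le> dhat k X \<omega> n i j"
    using rkhs_unit_ball_bound[OF pd f, of "empdiff n (\<lambda>l. X i l \<omega>) (\<lambda>l. X j l \<omega>)"]
    unfolding sum_list_empdiff dhat_eq_knorm2[OF pd] .
  then show "(\<integral>x. f x \<partial>p i) - (\<integral>x. f x \<partial>p j) \<le> sqrt (mmd2 i j) + e"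
    using s by linarith
qed

text \<open>The bound \<open>rkhs_integral_diff_le\<close> supplies the boundedness from above that
  gives the supremum its meaning.\<close>

lemma mmd_upper:
  assumes ij: "i < M" "j < M" "i \<noteq> j" and f: "f \<in> rkhs_unit_ball k"
  shows "(\<integral>x. f x \<partial>p i) - (\<integral>x. f x \<partial>p j) \<le> mmd k (p i) (p j)"
  unfolding mmd_def
  by (rule cSUP_upper[OF f]) (use rkhs_integral_diff_le[OF ij] in \<open>auto intro!: bdd_aboveI\<close>)

lemma mmd_nonneg:
  assumes "i < M" "j < M" "i \<noteq> j"
  shows "0 \<le> mmd k (p i) (p j)"
  using mmd_upper[OF assms zero_in_rkhs_unit_ball[OF pd]] by simp

text \<open>The witness is the normalised difference of the empirical embeddings of a representative
  sample; unlike the true mean embedding it is a finite kernel expansion.\<close>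
lemma mmd_ge:
  assumes ij: "i < M" "j < M" "i \<noteq> j"
  shows "sqrt (mmd2 i j) \<le> mmd k (p i) (p j)"
proof (cases "mmd2 i j = 0")
  case True
  then show ?thesis using mmd_nonneg[OF ij] by simp
next
  case False
  define d where "d = sqrt (mmd2 i j)"
  define r where "r = mmd k (p i) (p j)"
  have d: "0 < d" "d * d = mmd2 i j"
    using False mmd2_nonneg[OF ij] by (auto simp: d_def)
  have r: "0 \<le> r" using mmd_nonneg[OF ij] by (simp add: r_def)
  \<comment> \<open>The difference of the mean embeddings, an unnormalised population witness; its
    integrals under \<open>p i\<close> and \<open>p j\<close> differ by
    \<open>mmd2 i j\<close>.\<close>
  let ?u = "\<lambda>x. potential i x - potential j x"
  have u: "?u \<in> borel_measurable S" "\<And>x. \<bar>?u x\<bar> \<le> 2 * G"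
  proof -
    show "?u \<in> borel_measurable S"
      using potential_measurable ij by (intro borel_measurable_diff) auto
    show "\<bar>?u x\<bar> \<le> 2 * G" for x
      using potential_abs_le[OF ij(1), of x] potential_abs_le[OF ij(2), of x] by linarith
  qed
  have int: "integrable (p a) (potential b)" if "a < M" "b < M" for a b
    using that potential_measurable potential_abs_le by (intro integrable_bounded) auto
  have int_u: "(\<integral>x. ?u x \<partial>p i) - (\<integral>x. ?u x \<partial>p j) = d * d"
    using int ij theta_sym[OF ij(1,2)] by (simp add: d mmd2_def theta_def)
  have "d * d \<le> r * d"
  proof (rule field_le_epsilon)
    fix e :: real assume "0 < e"
    \<comment> \<open>The first bound keeps the normaliser \<open>q\<close> positive. The second
      absorbs the total error \<open>\<epsilon> * (r + 2)\<close>: twice \<epsilon> from the two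
      sample means and \<open>r * \<epsilon>\<close> from \<open>q < d + \<epsilon>\<close>.\<close>
    define \<epsilon> where "\<epsilon> = min (d / 2) (e / (r + 2))"
    have \<epsilon>: "0 < \<epsilon>" "\<epsilon> < d" using d r \<open>0 < e\<close> by (auto simp: \<epsilon>_def)
    have "\<epsilon> \<le> e / (r + 2)" by (simp add: \<epsilon>_def)
    then have \<epsilon>e: "\<epsilon> * (r + 2) \<le> e" using r by (simp add: field_simps)
    obtain n \<omega> where s: "\<bar>dhat k X \<omega> n i j - d\<bar> < \<epsilon>"
      "\<bar>(\<Sum>l=1..n. ?u (X i l \<omega>)) / real n - (\<integral>x. ?u x \<partial>p i)\<bar> < \<epsilon>"
      "\<bar>(\<Sum>l=1..n. ?u (X j l \<omega>)) / real n - (\<integral>x. ?u x \<partial>p j)\<bar> < \<epsilon>"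
      by (rule representative_sample[OF ij u \<epsilon>(1), folded d_def]) blast
    define q where "q = dhat k X \<omega> n i j"
    define ps where "ps = empdiff n (\<lambda>l. X i l \<omega>) (\<lambda>l. X j l \<omega>)"
    have q: "0 < q" "q < d + \<epsilon>" using s \<epsilon> by (auto simp: q_def)
    have "sqrt (knorm2 k ps) = q" by (simp add: q_def ps_def dhat_eq_knorm2[OF pd])
    then have "knorm2 k ps = q * q" using knorm2_nonneg[OF pd, of ps]
      by (metis real_sqrt_mult_self abs_of_nonneg)
    then have "knorm2 k (kscale (1 / q) ps) = 1"
      using q by (simp add: knorm2_eq_kform kform_scale_left kform_scale_right)
    then have ball: "kfun k (kscale (1 / q) ps) \<in> rkhs_unit_ball k"
      by (intro kfun_in_rkhs_unit_ball[OF pd]) simp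
    \<comment> \<open>The roles of sample and measure are exchanged: integrating the empirical
      witness against the true measures amounts to averaging \<open>?u\<close> over the
      samples.\<close>
    have "(\<integral>y. kfun k (kscale (1 / q) ps) y \<partial>p i) - (\<integral>y. kfun k (kscale (1 / q) ps) y \<partial>p j)
        = ((\<Sum>(c,x)\<leftarrow>ps. c * potential i x) - (\<Sum>(c,x)\<leftarrow>ps. c * potential j x)) / q"
      unfolding kfun_scale using integral_kfun ij by (simp add: diff_divide_distrib)
    also have "\<dots> = ((\<Sum>l=1..n. ?u (X i l \<omega>)) / real n - (\<Sum>l=1..n. ?u (X j l \<omega>)) / real n) / q"
      unfolding ps_def sum_list_empdiff by (simp add: sum_subtractf diff_divide_distrib)
    finally have "((\<Sum>l=1..n. ?u (X i l \<omega>)) / real n - (\<Sum>l=1..n. ?u (X j l \<omega>)) / real n) / q \<le> r"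
      using mmd_upper[OF ij ball] by (simp add: r_def)
    then have "(\<Sum>l=1..n. ?u (X i l \<omega>)) / real n - (\<Sum>l=1..n. ?u (X j l \<omega>)) / real n \<le> r * q"
      using q by (simp add: pos_divide_le_eq)
    also have "r * q \<le> r * (d + \<epsilon>)" using r q by (intro mult_left_mono) auto
    finally have "d * d - 2 * \<epsilon> \<le> r * (d + \<epsilon>)" using s int_u by linarith
    then show "d * d \<le> r * d + e" using \<epsilon>e by (simp add: algebra_simps)
  qed
  then have "d \<le> r" by (rule mult_right_le_imp_le[OF _ d(1)])
  then show ?thesis by (simp add: d_def r_def)
qed

lemma mmd_eq:
  assumes "i < M" "j < M" "i \<noteq> j"
  shows "mmd k (p i) (p j) = sqrt (mmd2 i j)"
proof (rule antisym[OF _ mmd_ge[OF assms]])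
  show "mmd k (p i) (p j) \<le> sqrt (mmd2 i j)"
    unfolding mmd_def
    by (rule cSUP_least) (use zero_in_rkhs_unit_ball[OF pd] rkhs_integral_diff_le[OF assms] in auto)
qed

text \<open>The bad event at time \<open>n\<close>. Pairs with \<open>i = j\<close> are left out, as
  linkages between disjoint clusters never evaluate the diagonal.\<close>

definition deviates :: "real \<Rightarrow> nat \<Rightarrow> 'w set" where
  "deviates \<epsilon> n = {\<omega>\<in>space \<Omega>. \<exists>i<M. \<exists>j<M. i \<noteq> j \<and> \<epsilon> \<le> \<bar>dhat k X \<omega> n i j - mmd k (p i) (p j)\<bar>}"

lemma deviates_exp_small:
  assumes "0 < \<epsilon>"
  shows "exp_small (deviates \<epsilon>)"
proof -
  let ?I = "{(i, j). i < M \<and> j < M \<and> i \<noteq> j}"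
  let ?E = "\<lambda>(i, j) n. {\<omega>\<in>space \<Omega>. \<epsilon> \<le> \<bar>dhat k X \<omega> n i j - sqrt (mmd2 i j)\<bar>}"
  have "finite ?I" by (rule finite_subset[of _ "{..<M} \<times> {..<M}"]) auto
  then have "exp_small (\<lambda>n. \<Union>a\<in>?I. ?E a n)"
    by (rule exp_small_UN) (use assms in \<open>auto intro: dhat_exp_small\<close>)
  moreover have "deviates \<epsilon> = (\<lambda>n. \<Union>a\<in>?I. ?E a n)"
  proof
    have eq: "\<bar>dhat k X \<omega> n i j - mmd k (p i) (p j)\<bar> = \<bar>dhat k X \<omega> n i j - sqrt (mmd2 i j)\<bar>"
      if "i < M" "j < M" "i \<noteq> j" for \<omega> n i j
      using mmd_eq that by simp
    show "deviates \<epsilon> n = (\<Union>a\<in>?I. ?E a n)" for n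
      unfolding deviates_def using eq by fastforce
  qed
  ultimately show ?thesis by simp
qed

end

section \<open>The stopping time\<close>

text \<open>Every time from \<open>n\<^sub>0\<close> on that precedes the first success lies in some
  \<open>B n\<close>, so the waiting time is at most \<open>n\<^sub>0\<close> plus the number of bad
  times. If no success occurs, every \<open>m\<close> satisfies this bound and the count is
  infinite. Being pointwise, the bound can be integrated term by term.\<close>

lemma ennreal_Least_le_count:
  fixes Q :: "nat \<Rightarrow> bool"
  assumes "\<And>n. n\<^sub>0 \<le> n \<Longrightarrow> \<not> Q n \<Longrightarrow> \<omega> \<in> B n"
  shows "ennreal_of_enat (if \<exists>n. Q n then enat (LEAST n. Q n) else \<infinity>)
    \<le> of_nat n\<^sub>0 + (\<Sum>n. indicator (B n) \<omega>)"
proof -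
  let ?s = "(\<Sum>n. indicator (B n) \<omega>) :: ennreal"
  have le: "of_nat m \<le> of_nat n\<^sub>0 + ?s" if "\<forall>n<m. \<not> Q n" for m
  proof -
    have "of_nat m \<le> (of_nat (n\<^sub>0 + card {n\<^sub>0..<m}) :: ennreal)"
      by (intro of_nat_mono) simp
    also have "\<dots> = of_nat n\<^sub>0 + (\<Sum>n\<in>{n\<^sub>0..<m}. 1)" by simp
    also have "(\<Sum>n\<in>{n\<^sub>0..<m}. 1) = (\<Sum>n\<in>{n\<^sub>0..<m}. indicator (B n) \<omega> :: ennreal)"
      using that assms by (intro sum.cong) auto
    also have "\<dots> \<le> ?s" by (intro sum_le_suminf) auto
    finally show ?thesis by simp
  qed
  show ?thesis
  proof (cases "\<exists>n. Q n")
    case True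
    have "of_nat (LEAST n. Q n) \<le> of_nat n\<^sub>0 + ?s" by (intro le allI impI not_less_Least)
    then show ?thesis using True by simp
  next
    case False
    then have "(SUP m. of_nat m) \<le> of_nat n\<^sub>0 + ?s" by (intro SUP_least le) auto
    then show ?thesis using False by (simp add: ennreal_SUP_of_nat_eq_top top_unique)
  qed
qed

context kernel_samples
begin

theorem slink_seq_exponentially_consistent:
  assumes P: "is_partition M K P" and K: "2 \<le> K"
    and sel: "\<And>n \<delta>. slink_out \<delta> M K (sel n \<delta>)"
    and gap: "d_I (\<lambda>i j. mmd k (p i) (p j)) P < d_H (\<lambda>i j. mmd k (p i) (p j)) P"
  shows "\<exists>\<alpha>>0. \<forall>\<^sub>F C in at_top.
    (\<integral>\<^sup>+ \<omega>. ennreal_of_enat (stop_time k X sel C \<omega>) \<partial>\<Omega>)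
      \<le> neglog (err_prob \<Omega> k X sel P C) * ennreal (1 / \<alpha>)"
proof -
  let ?d = "\<lambda>i j. mmd k (p i) (p j)"
  define h where "h = d_H ?d P"
  \<comment> \<open>Half the gap is the largest value that \<open>slink_out_correct\<close> admits.
    As \<open>d_I\<close> is nonnegative, it also leaves \<open>h - \<epsilon>\<close> at or above
    \<open>h / 2\<close>.\<close>
  define \<epsilon> where "\<epsilon> = (h - d_I ?d P) / 2"
  have dI: "0 \<le> d_I ?d P" by (rule d_I_nonneg[OF P K mmd_nonneg])
  have h: "0 < h" and \<epsilon>: "0 < \<epsilon>" "h / 2 \<le> h - \<epsilon>" "d_I ?d P + 2 * \<epsilon> \<le> h"
    using gap[folded h_def] dI by (simp_all add: \<epsilon>_def field_simps)
  obtain A c where c: "0 < c" and A: "0 \<le> A" "\<And>n. prob (deviates \<epsilon> n) \<le> A * exp (- c * real n)"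
    by (rule exp_smallE[OF deviates_exp_small[OF \<epsilon>(1)]]) blast
  have ev: "deviates \<epsilon> n \<in> events" for n
    using exp_small_events[OF deviates_exp_small[OF \<epsilon>(1)]] .
  define \<rho> where "\<rho> = exp (- c)"
  have \<rho>: "0 < \<rho>" "\<rho> < 1" using c by (auto simp: \<rho>_def)
  have A': "prob (deviates \<epsilon> n) \<le> A * \<rho> ^ n" for n
    using A(2)[of n] by (simp add: \<rho>_def exp_of_nat_mult[symmetric] mult.commute)
  \<comment> \<open>The total of the geometric bounds, hence a bound on the expected number of bad
    times.\<close>
  define B where "B = A / (1 - \<rho>)"
  have B: "0 \<le> B" using A \<rho> by (simp add: B_def)
  have sums: "(\<lambda>n. A * \<rho> ^ n) sums B"
    using sums_mult[OF geometric_sums[of \<rho>], of A] \<rho> by (simp add: B_def)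
  define Q where "Q C \<omega> n \<longleftrightarrow>
    2 \<le> n \<and> C / sqrt (real n) \<le> gamma (dhat k X \<omega> n) (sel n (dhat k X \<omega> n))" for C \<omega> n
  have stop: "stop_time k X sel C \<omega> = (if \<exists>n. Q C \<omega> n then enat (LEAST n. Q C \<omega> n) else \<infinity>)" for C \<omega>
    by (simp add: stop_time_def Q_def Let_def)
  have good: "sel n (dhat k X \<omega> n) = P" "h / 2 \<le> gamma (dhat k X \<omega> n) (sel n (dhat k X \<omega> n))"
    if "\<omega> \<in> space \<Omega>" "\<omega> \<notin> deviates \<epsilon> n" for \<omega> n
  proof -
    have close: "\<bar>dhat k X \<omega> n i j - ?d i j\<bar> < \<epsilon>" if "i < M" "j < M" "i \<noteq> j" for i j
      using that \<open>\<omega> \<in> space \<Omega>\<close> \<open>\<omega> \<notin> deviates \<epsilon> n\<close> unfolding deviates_def by (force simp: not_le)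
    note * = slink_out_correct[OF P K close \<epsilon>(3)[unfolded h_def] sel]
    show "sel n (dhat k X \<omega> n) = P" using *(1) by blast
    show "h / 2 \<le> gamma (dhat k X \<omega> n) (sel n (dhat k X \<omega> n))"
      using *(2)[of n] \<epsilon>(2) unfolding h_def by simp
  qed
  have stop_good: "Q C \<omega> n"
    if "\<omega> \<in> space \<Omega>" "\<omega> \<notin> deviates \<epsilon> n" "0 < C" "2 \<le> n" "4 * C\<^sup>2 / h\<^sup>2 \<le> real n" for C \<omega> n
  proof -
    have "2 * C / h = sqrt (4 * C\<^sup>2 / h\<^sup>2)"
      using h that by (simp add: real_sqrt_divide real_sqrt_mult)
    also have "\<dots> \<le> sqrt (real n)" using that by (intro real_sqrt_le_mono)
    finally have "C / sqrt (real n) \<le> h / 2" using h that by (simp add: field_simps)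
    then show ?thesis unfolding Q_def using order_trans[OF _ good(2)[OF that(1,2)]] that(4) by blast
  qed
  have stop_late: "C\<^sup>2 / (2 * G) \<le> real n" if "Q C \<omega> n" "0 < C" for C \<omega> n
  proof -
    have "gamma (dhat k X \<omega> n) (sel n (dhat k X \<omega> n)) \<le> sqrt (2 * G)"
      by (rule slink_out_gamma_le[OF sel is_partition_card_le[OF P] K dhat_le])
    then have "C / sqrt (real n) \<le> sqrt (2 * G)" "0 < n" using that by (auto simp: Q_def)
    then have "C \<le> sqrt (2 * G * real n)" by (simp add: real_sqrt_mult field_simps)
    then have "C\<^sup>2 \<le> (sqrt (2 * G * real n))\<^sup>2" using that by (intro power_mono) auto
    then show ?thesis using G_pos by (simp add: field_simps)
  qed

  \<comment> \<open>Expected stopping time\<close>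
  have mean_le: "(\<integral>\<^sup>+ \<omega>. ennreal_of_enat (stop_time k X sel C \<omega>) \<partial>\<Omega>) \<le> ennreal (4 * C\<^sup>2 / h\<^sup>2 + 3 + B)"
    if C: "0 < C" for C
  proof -
    \<comment> \<open>The summand 2 meets the constraint \<open>2 \<le> n\<close> of the stopping
      rule; rounding up costs at most one more, whence the 3 in the bound.\<close>
    define n\<^sub>1 where "n\<^sub>1 = nat \<lceil>4 * C\<^sup>2 / h\<^sup>2\<rceil> + 2"
    have n1: "4 * C\<^sup>2 / h\<^sup>2 \<le> real n" "2 \<le> n" if "n\<^sub>1 \<le> n" for n
      using that by (simp_all add: n\<^sub>1_def) linarith
    have n1': "real n\<^sub>1 \<le> 4 * C\<^sup>2 / h\<^sup>2 + 3"
    proof -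
      have "0 \<le> 4 * C\<^sup>2 / h\<^sup>2" by simp
      then show ?thesis unfolding n\<^sub>1_def by linarith
    qed
    have "(\<integral>\<^sup>+ \<omega>. ennreal_of_enat (stop_time k X sel C \<omega>) \<partial>\<Omega>)
        \<le> (\<integral>\<^sup>+ \<omega>. of_nat n\<^sub>1 + (\<Sum>n. indicator (deviates \<epsilon> n) \<omega>) \<partial>\<Omega>)"
      unfolding stop
      by (intro nn_integral_mono ennreal_Least_le_count) (use stop_good C n1 in blast)
    also have "\<dots> = of_nat n\<^sub>1 + (\<Sum>n. emeasure \<Omega> (deviates \<epsilon> n))"
      using ev by (simp add: nn_integral_add nn_integral_suminf emeasure_space_1)
    also have "\<dots> \<le> of_nat n\<^sub>1 + (\<Sum>n. ennreal (A * \<rho> ^ n))"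
      by (intro add_left_mono suminf_le summableI) (auto simp: emeasure_eq_measure A' intro!: ennreal_leI)
    also have "(\<Sum>n. ennreal (A * \<rho> ^ n)) = ennreal B"
      using A \<rho> by (intro suminf_ennreal_eq sums) auto
    also have "of_nat n\<^sub>1 + ennreal B = ennreal (real n\<^sub>1 + B)"
      using B by (simp add: ennreal_of_nat_eq_real_of_nat)
    also have "\<dots> \<le> ennreal (4 * C\<^sup>2 / h\<^sup>2 + 3 + B)" using n1' by (intro ennreal_leI) simp
    finally show ?thesis .
  qed

  \<comment> \<open>Error probability\<close>
  have err_le: "err_prob \<Omega> k X sel P C \<le> B * exp (- c * (C\<^sup>2 / (2 * G)))" if C: "0 < C" for C
  proof -
    define n\<^sub>0 where "n\<^sub>0 = nat \<lceil>C\<^sup>2 / (2 * G)\<rceil>"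
    have n0: "C\<^sup>2 / (2 * G) \<le> real n\<^sub>0" unfolding n\<^sub>0_def by linarith
    let ?E = "{\<omega> \<in> space \<Omega>. (case stop_time k X sel C \<omega> of enat n \<Rightarrow> sel n (dhat k X \<omega> n) \<noteq> P | \<infinity> \<Rightarrow> True)}"
    have sums': "(\<lambda>n. A * \<rho> ^ (n + n\<^sub>0)) sums (B * \<rho> ^ n\<^sub>0)"
      using sums_mult2[OF sums, of "\<rho> ^ n\<^sub>0"] by (simp add: power_add mult.assoc)
    have summ: "summable (\<lambda>n. prob (deviates \<epsilon> (n + n\<^sub>0)))"
      by (rule summable_comparison_test'[OF sums_summable[OF sums']]) (use A' in auto)
    have "?E \<subseteq> (\<Union>n. deviates \<epsilon> (n + n\<^sub>0))"
    proof
      fix \<omega> assume \<omega>: "\<omega> \<in> ?E"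
      show "\<omega> \<in> (\<Union>n. deviates \<epsilon> (n + n\<^sub>0))"
      proof (cases "\<exists>n. Q C \<omega> n")
        case True
        define m where "m = (LEAST n. Q C \<omega> n)"
        have "Q C \<omega> m" unfolding m_def using True by (rule LeastI_ex)
        then have "C\<^sup>2 / (2 * G) \<le> real m" using stop_late C by blast
        then have "n\<^sub>0 \<le> m" unfolding n\<^sub>0_def by linarith
        moreover have "sel m (dhat k X \<omega> m) \<noteq> P" using \<omega> True by (simp add: stop m_def)
        then have "\<omega> \<in> deviates \<epsilon> m" using good(1)[of \<omega> m] \<omega> by auto
        ultimately show ?thesis by (intro UN_I[of "m - n\<^sub>0"]) auto
      next
        case False
        \<comment> \<open>Never stopping counts as an error. Any single time beyond the threshold of
          \<open>stop_good\<close> is then a bad time, and adding \<open>n\<^sub>0\<close> places it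
          in the union.\<close>
        define m where "m = nat \<lceil>4 * C\<^sup>2 / h\<^sup>2\<rceil> + 2"
        have m: "4 * C\<^sup>2 / h\<^sup>2 \<le> real (m + n\<^sub>0)" "2 \<le> m + n\<^sub>0" unfolding m_def by linarith+
        then have "\<omega> \<in> deviates \<epsilon> (m + n\<^sub>0)"
          using stop_good[OF _ _ C m(2,1), of \<omega>] \<omega> False by auto
        then show ?thesis by blast
      qed
    qed
    then have "err_prob \<Omega> k X sel P C \<le> prob (\<Union>n. deviates \<epsilon> (n + n\<^sub>0))"
      unfolding err_prob_def using ev by (intro finite_measure_mono) auto
    also have "\<dots> \<le> (\<Sum>n. prob (deviates \<epsilon> (n + n\<^sub>0)))"
      using ev summ by (intro finite_measure_subadditive_countably) auto
    also have "\<dots> \<le> (\<Sum>n. A * \<rho> ^ (n + n\<^sub>0))"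
      by (rule suminf_le[OF A' summ sums_summable[OF sums']])
    also have "\<dots> = B * \<rho> ^ n\<^sub>0" using sums' by (rule sums_unique[symmetric])
    also have "\<rho> ^ n\<^sub>0 = exp (- c * real n\<^sub>0)"
      by (simp add: \<rho>_def exp_of_nat_mult[symmetric] mult.commute)
    also have "B * \<dots> \<le> B * exp (- c * (C\<^sup>2 / (2 * G)))"
      using B c n0 by (intro mult_left_mono) (auto intro!: mult_left_mono simp del: times_divide_eq_right)
    finally show ?thesis .
  qed
  \<comment> \<open>The added 1 absorbs the constant \<open>3 + B\<close> once \<open>C\<close> is
    large. The rate \<open>b\<close> is half of the available \<open>c / (2 * G)\<close>; the other
    half absorbs the factor \<open>B\<close>.\<close>
  define a where "a = 4 / h\<^sup>2 + 1"
  define b where "b = c / (4 * G)"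
  have ab: "0 < a" "0 < b" using c G_pos by (auto simp: a_def b_def intro: add_nonneg_pos)
  have main: "(\<integral>\<^sup>+ \<omega>. ennreal_of_enat (stop_time k X sel C \<omega>) \<partial>\<Omega>)
      \<le> neglog (err_prob \<Omega> k X sel P C) * ennreal (1 / (b / a))"
    if C: "1 \<le> C" "3 + B \<le> C" "B / b \<le> C" for C
  proof -
    have CC: "C \<le> C\<^sup>2" using C by (simp add: power2_eq_square)
    have "err_prob \<Omega> k X sel P C \<le> B * exp (- c * (C\<^sup>2 / (2 * G)))" using err_le C by simp
    also have "- c * (C\<^sup>2 / (2 * G)) = - (b * C\<^sup>2) + - (b * C\<^sup>2)"
      using G_pos by (simp add: b_def field_simps)
    also have "B * exp \<dots> = B * exp (- (b * C\<^sup>2)) * exp (- (b * C\<^sup>2))"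
      by (simp only: exp_add mult.assoc)
    also have "\<dots> \<le> 1 * exp (- (b * C\<^sup>2))"
    proof (rule mult_right_mono)
      have "B \<le> b * C" using C ab by (simp add: field_simps)
      also have "\<dots> \<le> b * C\<^sup>2" using CC ab by simp
      also have "\<dots> \<le> exp (b * C\<^sup>2)" using exp_ge_add_one_self[of "b * C\<^sup>2"] by linarith
      finally show "B * exp (- (b * C\<^sup>2)) \<le> 1" by (simp add: exp_minus field_simps)
    qed simp
    finally have err: "err_prob \<Omega> k X sel P C \<le> exp (- (b * C\<^sup>2))" by simp
    have nl: "ennreal (b * C\<^sup>2) \<le> neglog (err_prob \<Omega> k X sel P C)"
    \<comment> \<open>For error probability zero, \<open>neglog\<close> is infinite and the bound is
      immediate.\<close>
    proof (cases "err_prob \<Omega> k X sel P C \<le> 0")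
      case False
      then have "ln (err_prob \<Omega> k X sel P C) \<le> - (b * C\<^sup>2)"
        using err by (metis ln_exp ln_mono not_le)
      then show ?thesis using False by (simp add: neglog_def ennreal_leI)
    qed (simp add: neglog_def)
    have "(\<integral>\<^sup>+ \<omega>. ennreal_of_enat (stop_time k X sel C \<omega>) \<partial>\<Omega>) \<le> ennreal (4 * C\<^sup>2 / h\<^sup>2 + 3 + B)"
      using mean_le C by simp
    also have "\<dots> \<le> ennreal (a * C\<^sup>2)"
      using C CC by (intro ennreal_leI) (simp add: a_def algebra_simps)
    also have "a * C\<^sup>2 = (b * C\<^sup>2) * (1 / (b / a))" using ab by simp
    also have "ennreal \<dots> = ennreal (b * C\<^sup>2) * ennreal (1 / (b / a))"
      using ab by (intro ennreal_mult) auto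
    also have "\<dots> \<le> neglog (err_prob \<Omega> k X sel P C) * ennreal (1 / (b / a))"
      using nl by (rule mult_right_mono) simp
    finally show ?thesis .
  qed
  show ?thesis
  proof (intro exI conjI)
    show "0 < b / a" using ab by simp
    show "\<forall>\<^sub>F C in at_top. (\<integral>\<^sup>+ \<omega>. ennreal_of_enat (stop_time k X sel C \<omega>) \<partial>\<Omega>)
      \<le> neglog (err_prob \<Omega> k X sel P C) * ennreal (1 / (b / a))"
      using eventually_ge_at_top[of "max 1 (max (3 + B) (B / b))"]
      by eventually_elim (rule main; simp)
  qed
qed

end

theorem theorem5:
  fixes \<Omega> :: "'w measure" and S :: "'x measure"
    and X :: "nat \<Rightarrow> nat \<Rightarrow> 'w \<Rightarrow> 'x" and p :: "nat \<Rightarrow> 'x measure"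
    and k :: "'x \<Rightarrow> 'x \<Rightarrow> real" and G :: real and M K :: nat
    and P :: "nat set set"
    and sel :: "nat \<Rightarrow> (nat \<Rightarrow> nat \<Rightarrow> real) \<Rightarrow> nat set set"
  assumes "prob_space \<Omega>"
    and "space S = UNIV"
    and "2 \<le> M" and "2 \<le> K"
    and "\<And>i. i < M \<Longrightarrow> prob_space (p i) \<and> sets (p i) = sets S"
    and "\<And>i l. i < M \<Longrightarrow> 1 \<le> l \<Longrightarrow> X i l \<in> measurable \<Omega> S \<and> distr \<Omega> S (X i l) = p i"
    and "prob_space.indep_vars \<Omega> (\<lambda>_. S) (\<lambda>(i,l). X i l) ({..<M} \<times> {1..})"
    and "pd_kernel k"
    and "(\<lambda>(x,y). k x y) \<in> borel_measurable (S \<Otimes>\<^sub>M S)"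
    and "\<And>x y. 0 \<le> k x y \<and> k x y \<le> G"
    and "is_partition M K P"
    and "\<And>n \<delta>. slink_out \<delta> M K (sel n \<delta>)"
    and "\<And>n. (\<lambda>\<omega>. sel n (dhat k X \<omega> n)) \<in> measurable \<Omega> (count_space UNIV)"
    and "d_I (\<lambda>i j. mmd k (p i) (p j)) P < d_H (\<lambda>i j. mmd k (p i) (p j)) P"
  shows "\<exists>\<alpha>>0. \<exists>g :: real \<Rightarrow> real. (g \<longlongrightarrow> 0) at_top \<and>
           (\<forall>\<^sub>F C in at_top.
              (\<integral>\<^sup>+ \<omega>. ennreal_of_enat (stop_time k X sel C \<omega>) \<partial>\<Omega>)
                \<le> neglog (err_prob \<Omega> k X sel P C) * ennreal ((1 + g C) / \<alpha>))"
proof -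
  interpret prob_space \<Omega> by fact
  \<comment> \<open>\<open>G = 0\<close> is allowed, but Hoeffding's inequality needs an interval of positive length.\<close>
  have "0 \<le> G" using assms(10) order_trans by blast
  then have bounds: "k x y \<le> G + 1" "0 < G + 1" for x y
    using assms(10)[of x y] by linarith+
  interpret kernel_samples \<Omega> S X p k "G + 1" M
  proof (intro kernel_samples.intro kernel_samples_axioms.intro)
    show "prob_space \<Omega>" "space S = UNIV" "pd_kernel k" "(\<lambda>(x,y). k x y) \<in> borel_measurable (S \<Otimes>\<^sub>M S)"
      and "indep_vars (\<lambda>_. S) (\<lambda>(i,l). X i l) ({..<M} \<times> {1..})" by fact+
    show "prob_space (p i)" "sets (p i) = sets S" if "i < M" for i
      using assms(5)[OF that] by auto
    show "X i l \<in> measurable \<Omega> S" "distr \<Omega> S (X i l) = p i" if "i < M" "1 \<le> l" for i l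
      using assms(6)[OF that] by auto
    show "0 \<le> k x y" for x y using assms(10) by auto
  qed (fact bounds)+
  obtain \<alpha> where "0 < \<alpha>" "\<forall>\<^sub>F C in at_top.
      (\<integral>\<^sup>+ \<omega>. ennreal_of_enat (stop_time k X sel C \<omega>) \<partial>\<Omega>)
        \<le> neglog (err_prob \<Omega> k X sel P C) * ennreal (1 / \<alpha>)"
    using slink_seq_exponentially_consistent[where sel = sel, OF assms(11,4,12,14)] by auto
  \<comment> \<open>For large \<open>C\<close> the inequality holds without any correction, so the
    zero function serves as the vanishing term.\<close>
  then show ?thesis by (intro exI[of _ \<alpha>] conjI exI[of _ "\<lambda>_. 0"]) auto
qed

end
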